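(* For every $(t,x,p)\in[0,T]\times\mathbb{R}^d\times\Delta(I)$ the game has a value, i.e. $V^+(t,x,p)=V^-(t,x,p)$; the value of the game is given by $$V(t,x,p):=V^+(t,x,p)=V^-(t,x,p),$$ where $V^-(t,x,p)=\sup_{\nu\in\mathcal{T}^r(t)}\inf_{\mu\in(\mathcal{T}^r(t))^I}J(t,x,p,\mu,\nu)$ and $V^+(t,x,p)=\inf_{\mu\in(\mathcal{T}^r(t))^I}\sup_{\nu\in\mathcal{T}^r(t)}J(t,x,p,\mu,\nu)$.
   Context: Fix $T>0$ and $d,I\in\mathbb{N}^*$; $\Delta(I)=\{p\in[0,1]^I:\sum_i p_i=1\}$. Let $\mathcal{C}([0,T];\mathbb{R}^d)$ be the set of continuous functions from $\mathbb{R}$ to $\mathbb{R}^d$ constant on $(-\infty,0]$ and on $[T,+\infty)$, $B$ its coordinate process, $\mathbb{P}_0$ the Wiener measure, $(\mathcal{H}_s)$ the filtration generated by $B$, and $\mathcal{H}_{t,s}$ the $\sigma$-algebra generated by paths up to time $s$ in $\mathcal{C}([t,T];\mathbb{R}^d)$ (so it carries no information on the Brownian path before $t$), all augmented by $\mathbb{P}_0$-nullsets. For $(t,x)\in[0,T]\times\mathbb{R}^d$ let $X^{t,x}$ solve $dX_s=b(s,X_s)ds+a(s,X_s)dB_s$, $X_t=x$. Standing assumptions: $b:[0,T]\times\mathbb{R}^d\to\mathbb{R}^d$ and all entries $a_{k,l}:[0,T]\times\mathbb{R}^d\to\mathbb{R}$ ($1\le k,l\le d$) are bounded and Lipschitz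 in $(t,x)$. The functions $g_i:\mathbb{R}^d\to\mathbb{R}$ and $f_i,h_i:[0,T]\times\mathbb{R}^d\to\mathbb{R}$ ($i=1,\dots,I$) are bounded and Lipschitz continuous, with $f_i(t,x)\le h_i(t,x)$ and $f_i(T,x)\le g_i(x)\le h_i(T,x)$ for all $i,t,x$. $\mathcal{T}(t)$ is the set of $(\mathcal{H}_{t,s})_{s\in[t,T]}$ stopping times with values in $[t,T]$. A randomized stopping time after $t$ is a measurable $\mu:[0,1]\times\mathcal{C}([t,T];\mathbb{R}^d)\to[t,T]$ such that $\mu(r,\cdot)\in\mathcal{T}(t)$ for every $r\in[0,1]$; the set of these is $\mathcal{T}^r(t)$. For $\mu=(\mu_i)_i\in(\mathcal{T}^r(t))^I$, $\nu\in\mathcal{T}^r(t)$, with expectation under $\mathbb{P}_0\otimes\lambda\otimes\lambda$ ($\lambda$ Lebesgue measure on $[0,1]$, the two copies being the independent randomizations of the two players), $$J_i(t,x,\mu_i,\nu)=\mathbb{E}\big[f_i(\nu,X^{t,x}_\nu)1_{\nu<\mu_i,\nu<T}+h_i(\mu_i,X^{t,x}_{\mu_i})1_{\mu_i\le\nu,\mu_i<T}+g_i(X^{t,x}_T)1_{\mu_i=\nu=T}\big],$$ $$J(t,x,p,\mu,\nu)=\sum_{i=1}^I p_iJ_i(t,x,\mu_i,\nu).$$ *)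

theory Defs
  imports "HOL-Probability.Probability"
begin

section \<open>Path space and Wiener measure\<close>

type_synonym 'd path = "real \<Rightarrow> real ^ 'd"

text \<open>The space of continuous paths on [t, T], realised as functions on the whole real line that
  are constant before t and after T.\<close>

definition paths :: "real \<Rightarrow> real \<Rightarrow> ('d::finite) path set" where
  "paths t T = {\<omega>. continuous_on UNIV \<omega> \<and> (\<forall>s\<le>t. \<omega> s = \<omega> t) \<and> (\<forall>s\<ge>T. \<omega> s = \<omega> T)}"

definition coord_events :: "real \<Rightarrow> real \<Rightarrow> real \<Rightarrow> ('d::finite) path set set" where
  "coord_events t T s = {{\<omega> \<in> paths t T. \<omega> r \<in> A} | r A. r \<in> {t..s} \<and> A \<in> sets borel}"

definition coord_algebra :: "real \<Rightarrow> real \<Rightarrow> real \<Rightarrow> ('d::finite) path measure" where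
  "coord_algebra t T s = sigma (paths t T) (coord_events t T s)"

definition wiener_measure :: "real \<Rightarrow> ('d::finite) path measure \<Rightarrow> bool" where
  "wiener_measure T P \<longleftrightarrow>
     prob_space P \<and> space P = paths 0 T \<and> sets P = sets (coord_algebra 0 T T) \<and>
     (AE \<omega> in P. \<omega> 0 = 0) \<and>
     (\<forall>s u. 0 \<le> s \<and> s < u \<and> u \<le> T \<longrightarrow>
        (\<forall>k. distributed P lborel (\<lambda>\<omega>. \<omega> u $ k - \<omega> s $ k)
               (\<lambda>z. ennreal (normal_density 0 (sqrt (u - s)) z))) \<and>
        prob_space.indep_vars P (\<lambda>_. borel) (\<lambda>k \<omega>. \<omega> u $ k - \<omega> s $ k) UNIV \<and>
        prob_space.indep_set P (sets (coord_algebra 0 T s))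
          (sets (vimage_algebra (paths 0 T) (\<lambda>\<omega>. \<omega> u - \<omega> s) borel)))"

text \<open>A path on [0, T] induces a path on [t, T] by restarting it from the origin at time t; only
  the increments after t are kept, so nothing about the path before t is revealed. The image of
  Wiener measure is the Wiener measure on the paths on [t, T].\<close>

definition restart :: "real \<Rightarrow> ('d::finite) path \<Rightarrow> 'd path" where
  "restart t \<omega> = (\<lambda>s. \<omega> (max t s) - \<omega> t)"

definition restarted_measure ::
    "real \<Rightarrow> ('d::finite) path measure \<Rightarrow> real \<Rightarrow> 'd path measure" where
  "restarted_measure T P t = distr P (coord_algebra t T T) (restart t)"

text \<open>The coordinate filtration on the paths on [t, T], augmented by the (completed) null sets of a
  measure M on that space.\<close>

definition aug_filtration ::
    "real \<Rightarrow> real \<Rightarrow> ('d::finite) path measure \<Rightarrow> real \<Rightarrow> 'd path measure" where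
  "aug_filtration t T M s = sigma (paths t T) (coord_events t T s \<union> null_sets (completion M))"

abbreviation filtration_H ::
    "real \<Rightarrow> ('d::finite) path measure \<Rightarrow> real \<Rightarrow> 'd path measure" where
  "filtration_H T P \<equiv> aug_filtration 0 T P"

abbreviation filtration_Ht ::
    "real \<Rightarrow> ('d::finite) path measure \<Rightarrow> real \<Rightarrow> real \<Rightarrow> 'd path measure" where
  "filtration_Ht T P t \<equiv> aug_filtration t T (restarted_measure T P t)"


section \<open>Stochastic integral and stochastic differential equation\<close>

text \<open>A simple integrand on [t, s] is given by a partition
  \<open>t = \<pi> 0 \<le> \<dots> \<le> \<pi> n = s\<close> and bounded weights \<open>\<xi> j\<close>, known at time \<open>\<pi> j\<close> and used
  on \<open>{\<pi> j<..\<pi> (Suc j)}\<close>.\<close>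

definition simple_data ::
    "real \<Rightarrow> ('d::finite) path measure \<Rightarrow> real \<Rightarrow> real \<Rightarrow>
     nat \<Rightarrow> (nat \<Rightarrow> real) \<Rightarrow> (nat \<Rightarrow> 'd path \<Rightarrow> real) \<Rightarrow> bool" where
  "simple_data T P t s n \<pi> \<xi> \<longleftrightarrow>
     \<pi> 0 = t \<and> \<pi> n = s \<and> (\<forall>j<n. \<pi> j \<le> \<pi> (Suc j)) \<and>
     (\<forall>j<n. \<xi> j \<in> borel_measurable (filtration_H T P (\<pi> j)) \<and>
            bounded (\<xi> j ` paths 0 T))"

definition simple_integrand ::
    "nat \<Rightarrow> (nat \<Rightarrow> real) \<Rightarrow> (nat \<Rightarrow> ('d::finite) path \<Rightarrow> real) \<Rightarrow> real \<Rightarrow> 'd path \<Rightarrow> real" where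
  "simple_integrand n \<pi> \<xi> u \<omega> = (\<Sum>j<n. \<xi> j \<omega> * indicator {\<pi> j<..\<pi> (Suc j)} u)"

definition simple_integral ::
    "'d \<Rightarrow> nat \<Rightarrow> (nat \<Rightarrow> real) \<Rightarrow> (nat \<Rightarrow> ('d::finite) path \<Rightarrow> real) \<Rightarrow> 'd path \<Rightarrow> real" where
  "simple_integral l n \<pi> \<xi> \<omega> = (\<Sum>j<n. \<xi> j \<omega> * (\<omega> (\<pi> (Suc j)) $ l - \<omega> (\<pi> j) $ l))"

text \<open>\<open>Z\<close> is the integral of \<open>H\<close> over [t, s] against the \<open>l\<close>-th Brownian coordinate, as an
  \<open>L\<^sup>2\<close> limit of integrals of simple integrands converging to \<open>H\<close>.\<close>

definition has_ito_integral ::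
    "real \<Rightarrow> ('d::finite) path measure \<Rightarrow> 'd \<Rightarrow> real \<Rightarrow> real \<Rightarrow>
     (real \<Rightarrow> 'd path \<Rightarrow> real) \<Rightarrow> ('d path \<Rightarrow> real) \<Rightarrow> bool" where
  "has_ito_integral T P l t s H Z \<longleftrightarrow>
     (\<lambda>(u, \<omega>). H u \<omega>) \<in> borel_measurable (restrict_space lborel {t..s} \<Otimes>\<^sub>M completion P) \<and>
     Z \<in> borel_measurable (completion P) \<and>
     (\<exists>n \<pi> \<xi>.
        (\<forall>m. simple_data T P t s (n m) (\<pi> m) (\<xi> m)) \<and>
        (\<lambda>m. \<integral>\<^sup>+(u, \<omega>). ennreal ((simple_integrand (n m) (\<pi> m) (\<xi> m) u \<omega> - H u \<omega>)\<^sup>2)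
               \<partial>(restrict_space lborel {t..s} \<Otimes>\<^sub>M completion P)) \<longlonglongrightarrow> 0 \<and>
        (\<lambda>m. \<integral>\<^sup>+\<omega>. ennreal ((simple_integral l (n m) (\<pi> m) (\<xi> m) \<omega> - Z \<omega>)\<^sup>2)
               \<partial>completion P) \<longlonglongrightarrow> 0)"

text \<open>\<open>X\<close> is a (strong) solution on [t, T] of
  \<open>dX = b(s, X) ds + a(s, X) dB\<close>, \<open>X t = x\<close>.\<close>

definition sde_solution ::
    "real \<Rightarrow> ('d::finite) path measure \<Rightarrow> (real \<Rightarrow> real ^ 'd \<Rightarrow> real ^ 'd) \<Rightarrow>
     (real \<Rightarrow> real ^ 'd \<Rightarrow> real ^ 'd ^ 'd) \<Rightarrow> real \<Rightarrow> real ^ 'd \<Rightarrow>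
     (real \<Rightarrow> 'd path \<Rightarrow> real ^ 'd) \<Rightarrow> bool" where
  "sde_solution T P b a t x X \<longleftrightarrow>
     (\<forall>\<omega>\<in>paths 0 T. continuous_on {t..T} (\<lambda>s. X s \<omega>)) \<and>
     (\<forall>s\<in>{t..T}. X s \<in> borel_measurable (filtration_H T P s)) \<and>
     (\<forall>s\<in>{t..T}. \<exists>Z.
        (\<forall>k l. has_ito_integral T P l t s (\<lambda>u \<omega>. a u (X u \<omega>) $ k $ l) (Z k l)) \<and>
        (AE \<omega> in completion P. \<forall>k.
           X s \<omega> $ k = x $ k + (LINT u:{t..s}|lborel. b u (X u \<omega>) $ k) + (\<Sum>l\<in>UNIV. Z k l \<omega>)))"

definition bounded_lipschitz ::
    "real \<Rightarrow> (real \<Rightarrow> 'v::real_normed_vector \<Rightarrow> 'w::real_normed_vector) \<Rightarrow> bool" where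
  "bounded_lipschitz T \<phi> \<longleftrightarrow>
     bounded ((\<lambda>(s, y). \<phi> s y) ` ({0..T} \<times> UNIV)) \<and>
     (\<exists>L. L-lipschitz_on ({0..T} \<times> UNIV) (\<lambda>(s, y). \<phi> s y))"


section \<open>Randomized stopping times, payoff and values\<close>

definition stopping_times ::
    "real \<Rightarrow> ('d::finite) path measure \<Rightarrow> real \<Rightarrow> ('d path \<Rightarrow> real) set" where
  "stopping_times T P t =
     {\<tau>. stopping_time (filtration_Ht T P t) \<tau> \<and> \<tau> \<in> paths t T \<rightarrow> {t..T}}"

definition unit_measure :: "real measure" where
  "unit_measure = restrict_space lborel {0..1}"

definition randomized_stopping_times ::
    "real \<Rightarrow> ('d::finite) path measure \<Rightarrow> real \<Rightarrow> (real \<Rightarrow> 'd path \<Rightarrow> real) set" where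
  "randomized_stopping_times T P t =
     {\<mu>. (\<lambda>(r, \<omega>). \<mu> r \<omega>) \<in> borel_measurable (unit_measure \<Otimes>\<^sub>M filtration_Ht T P t T) \<and>
         (\<forall>r\<in>{0..1}. \<mu> r \<in> stopping_times T P t)}"

definition stopped_payoff ::
    "real \<Rightarrow> (real \<Rightarrow> real ^ 'd \<Rightarrow> real) \<Rightarrow> (real \<Rightarrow> real ^ 'd \<Rightarrow> real) \<Rightarrow>
     (real ^ 'd \<Rightarrow> real) \<Rightarrow> (real \<Rightarrow> real ^ 'd) \<Rightarrow> real \<Rightarrow> real \<Rightarrow> real" where
  "stopped_payoff T f h g y m n =
     f n (y n) * of_bool (n < m \<and> n < T) +
     h m (y m) * of_bool (m \<le> n \<and> m < T) +
     g (y T) * of_bool (m = T \<and> n = T)"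

definition payoff_i ::
    "real \<Rightarrow> ('d::finite) path measure \<Rightarrow> real \<Rightarrow> (real \<Rightarrow> 'd path \<Rightarrow> real ^ 'd) \<Rightarrow>
     (real \<Rightarrow> real ^ 'd \<Rightarrow> real) \<Rightarrow> (real \<Rightarrow> real ^ 'd \<Rightarrow> real) \<Rightarrow> (real ^ 'd \<Rightarrow> real) \<Rightarrow>
     (real \<Rightarrow> 'd path \<Rightarrow> real) \<Rightarrow> (real \<Rightarrow> 'd path \<Rightarrow> real) \<Rightarrow> real" where
  "payoff_i T P t X f h g \<mu> \<nu> =
     (LINT (\<omega>, r, q)|(completion P \<Otimes>\<^sub>M (unit_measure \<Otimes>\<^sub>M unit_measure)).
        stopped_payoff T f h g (\<lambda>s. X s \<omega>) (\<mu> r (restart t \<omega>)) (\<nu> q (restart t \<omega>)))"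

text \<open>Here \<open>X\<close> is the family of all solutions: \<open>X t x\<close> is the process started from \<open>x\<close> at
  time \<open>t\<close>.\<close>

definition payoff ::
    "real \<Rightarrow> ('d::finite) path measure \<Rightarrow>
     (real \<Rightarrow> real ^ 'd \<Rightarrow> real \<Rightarrow> 'd path \<Rightarrow> real ^ 'd) \<Rightarrow>
     ('i::finite \<Rightarrow> real \<Rightarrow> real ^ 'd \<Rightarrow> real) \<Rightarrow> ('i \<Rightarrow> real \<Rightarrow> real ^ 'd \<Rightarrow> real) \<Rightarrow>
     ('i \<Rightarrow> real ^ 'd \<Rightarrow> real) \<Rightarrow> real \<Rightarrow> real ^ 'd \<Rightarrow> real ^ 'i \<Rightarrow>
     ('i \<Rightarrow> real \<Rightarrow> 'd path \<Rightarrow> real) \<Rightarrow> (real \<Rightarrow> 'd path \<Rightarrow> real) \<Rightarrow> real" where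
  "payoff T P X f h g t x p \<mu> \<nu> =
     (\<Sum>i\<in>UNIV. p $ i * payoff_i T P t (X t x) (f i) (h i) (g i) (\<mu> i) \<nu>)"

definition prob_simplex :: "(real ^ 'i::finite) set" where
  "prob_simplex = {p. (\<forall>i. p $ i \<in> {0..1}) \<and> (\<Sum>i\<in>UNIV. p $ i) = 1}"

text \<open>Suprema and infima are taken in the extended reals, where they always exist.\<close>

definition lower_value ::
    "real \<Rightarrow> ('d::finite) path measure \<Rightarrow>
     (real \<Rightarrow> real ^ 'd \<Rightarrow> real \<Rightarrow> 'd path \<Rightarrow> real ^ 'd) \<Rightarrow>
     ('i::finite \<Rightarrow> real \<Rightarrow> real ^ 'd \<Rightarrow> real) \<Rightarrow> ('i \<Rightarrow> real \<Rightarrow> real ^ 'd \<Rightarrow> real) \<Rightarrow>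
     ('i \<Rightarrow> real ^ 'd \<Rightarrow> real) \<Rightarrow> real \<Rightarrow> real ^ 'd \<Rightarrow> real ^ 'i \<Rightarrow> ereal" where
  "lower_value T P X f h g t x p =
     (SUP \<nu>\<in>randomized_stopping_times T P t.
        INF \<mu>\<in>{\<mu>. \<forall>i. \<mu> i \<in> randomized_stopping_times T P t}.
          ereal (payoff T P X f h g t x p \<mu> \<nu>))"

definition upper_value ::
    "real \<Rightarrow> ('d::finite) path measure \<Rightarrow>
     (real \<Rightarrow> real ^ 'd \<Rightarrow> real \<Rightarrow> 'd path \<Rightarrow> real ^ 'd) \<Rightarrow>
     ('i::finite \<Rightarrow> real \<Rightarrow> real ^ 'd \<Rightarrow> real) \<Rightarrow> ('i \<Rightarrow> real \<Rightarrow> real ^ 'd \<Rightarrow> real) \<Rightarrow>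
     ('i \<Rightarrow> real ^ 'd \<Rightarrow> real) \<Rightarrow> real \<Rightarrow> real ^ 'd \<Rightarrow> real ^ 'i \<Rightarrow> ereal" where
  "upper_value T P X f h g t x p =
     (INF \<mu>\<in>{\<mu>. \<forall>i. \<mu> i \<in> randomized_stopping_times T P t}.
        SUP \<nu>\<in>randomized_stopping_times T P t.
          ereal (payoff T P X f h g t x p \<mu> \<nu>))"

end

theory Submission
  imports Defs
begin

text \<open>
  Each player loses at most an arbitrarily small amount by rounding up to the next point of a fine
  time grid when the opponent already stops on the grid: the payoffs are continuous along paths and
  \<open>f \<le> g \<le> h\<close> makes simultaneous stopping harmless. On a grid, the expected cost depends on a
  randomized stopping time only through the conditional probabilities \<open>stop_prob\<close> of stopping at
  each grid point, given the path. It is bilinear in these, and continuous in the \<open>L\<^sup>2\<close> norm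
  uniformly in the opponent.

  This replaces the weak compactness usually needed in a minimax theorem. Finitely many opponents are
  handled by a finite minimax argument, and among the strategies good against finitely many
  opponents one takes an element of almost minimal \<open>L\<^sup>2\<close> norm. By the parallelogram identity,
  further opponents hardly move it, so it is almost optimal against all of them.

  The stochastic differential equation enters only through the continuity and measurability of its
  solutions.
\<close>

text \<open>The obstacle is the diagonal: the payoff may jump where the two stopping times cross, so
  closeness of two randomized times says little about their costs. On a finite grid the jumps are
  absorbed into finitely many bounded coefficients, multiplied by products of two conditional
  probabilities. Rounding goes upward because a delayed stopping time is still a stopping time. Its
  error is uniform over strategies because the exceptional event concerns only the oscillation of
  the costs along the path.

  The L^2 norm matters for its uniform convexity, not as a topology in which strategies converge:
  only near-minimizers are compared, so no limit strategy has to be constructed and shown to be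
  adapted. Only the minimizer is treated this way; the maximizer enters through averaging alone.
  Averages stay inside the strategy set because one uniform variable can be split into a coin and a
  fresh uniform variable.\<close>

section \<open>Minimax without compactness\<close>

text \<open>A separation argument in the plane. Where \<open>u a\<close> is negative, the wanted
  inequality bounds \<theta> from below by the zero of an affine function; where \<open>w a\<close>
  is negative, it bounds \<theta> from above. A common \<theta> exists unless some lower bound
  exceeds some upper one, and then a suitable mixture of the two culprits makes \<open>u\<close> and
  \<open>w\<close> both negative.\<close>

lemma two_function_alternative:
  fixes u w :: "'a \<Rightarrow> real"
  assumes mix: "\<And>a a' \<theta>. a \<in> A \<Longrightarrow> a' \<in> A \<Longrightarrow> 0 \<le> \<theta> \<Longrightarrow> \<theta> \<le> 1 \<Longrightarrow>
      \<exists>c\<in>A. u c \<le> (1 - \<theta>) * u a + \<theta> * u a' \<and> w c \<le> (1 - \<theta>) * w a + \<theta> * w a'"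
    and alt: "\<And>a. a \<in> A \<Longrightarrow> u a \<ge> 0 \<or> w a \<ge> 0"
  shows "\<exists>\<theta>\<in>{0..1}. \<forall>a\<in>A. (1 - \<theta>) * u a + \<theta> * w a \<ge> 0"
proof -
  \<comment> \<open>The added 0 here and the added 1 in \<open>R\<close> keep \<theta> in the unit
    interval; the 0 also makes \<open>L\<close> nonempty, so that its supremum can serve as
    \<theta>.\<close>
  define L where "L = insert 0 {u a / (u a - w a) | a. a \<in> A \<and> u a < 0}"
  define R where "R = insert 1 {u a / (u a - w a) | a. a \<in> A \<and> w a < 0}"
  have L01: "x \<in> {0..1}" if xL: "x \<in> L" for x
    proof (cases "x = 0")
    case False
    then obtain a where a: "a \<in> A" "u a < 0" "x = u a / (u a - w a)" using False xL unfolding L_def by auto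
    have "w a \<ge> 0" using alt[OF a(1)] a(2) by linarith
    thus ?thesis using a(2) unfolding a(3) by (simp add: divide_simps)
  qed simp
  have R01: "x \<in> {0..1}" if xR: "x \<in> R" for x
    proof (cases "x = 1")
    case False
    then obtain a where a: "a \<in> A" "w a < 0" "x = u a / (u a - w a)" using False xR unfolding R_def by auto
    have "u a \<ge> 0" using alt[OF a(1)] a(2) by linarith
    thus ?thesis using a(2) unfolding a(3) by (simp add: divide_simps)
  qed simp
  have cross: "u a' / (u a' - w a') \<le> u a / (u a - w a)"
    if a: "a \<in> A" "w a < 0" and a': "a' \<in> A" "u a' < 0" for a a'
  proof (rule ccontr)
    assume neg: "\<not> ?thesis"
    have ua: "u a \<ge> 0" and wa': "w a' \<ge> 0" using alt a a' by force+
    have "u a' * (u a - w a) < u a * (u a' - w a')"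
      using neg ua wa' a a' by (simp add: field_simps)
    hence prod: "u a * w a' < u a' * w a" by (simp add: algebra_simps)
    \<comment> \<open>\<open>l\<close> and \<open>r\<close> are the weights at which the averages of
      \<open>u\<close> and of \<open>w\<close> vanish; any weight strictly between them makes both
      averages negative. Cleared of denominators, \<open>l < r\<close> is
      \<open>prod\<close>.\<close>
    define l where "l = u a / (u a - u a')"
    define r where "r = - w a / (w a' - w a)"
    have "l < r"
      using ua wa' a a' prod unfolding l_def r_def by (simp add: field_simps)
    moreover have "0 \<le> l" "r \<le> 1"
      using ua wa' a a' unfolding l_def r_def by (simp_all add: field_simps)
    ultimately obtain \<theta> where th: "l < \<theta>" "\<theta> < r" "0 \<le> \<theta>" "\<theta> \<le> 1"
      using dense[of l r] by force
    obtain c where c: "c \<in> A" "u c \<le> (1 - \<theta>) * u a + \<theta> * u a'"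
        "w c \<le> (1 - \<theta>) * w a + \<theta> * w a'"
      using mix[OF a(1) a'(1) th(3,4)] by blast
    have "(1 - \<theta>) * u a + \<theta> * u a' < 0"
      using th(1) ua a' unfolding l_def by (simp add: field_simps)
    moreover have "(1 - \<theta>) * w a + \<theta> * w a' < 0"
      using th(2) wa' a unfolding r_def by (simp add: field_simps)
    ultimately show False using c alt[of c] by linarith
  qed
  have LR: "x \<le> y" if xy: "x \<in> L" "y \<in> R" for x y
  proof (cases "x = 0 \<or> y = 1")
    case True
    thus ?thesis using L01[OF xy(1)] R01[OF xy(2)] by auto
  next
    case False
    then obtain a a' where "a' \<in> A" "u a' < 0" "x = u a' / (u a' - w a')"
      "a \<in> A" "w a < 0" "y = u a / (u a - w a)"
      using xy by (auto simp: L_def R_def)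
    thus ?thesis using cross by simp
  qed
  define \<theta> where "\<theta> = Sup L"
  have bdd: "bdd_above L" and ne: "L \<noteq> {}" using L01 by (meson atLeastAtMost_iff bdd_aboveI) (simp add: L_def)
  have up: "x \<le> \<theta>" if "x \<in> L" for x
    unfolding \<theta>_def by (rule cSup_upper[OF that bdd])
  have lo: "\<theta> \<le> y" if "y \<in> R" for y
    unfolding \<theta>_def by (rule cSup_least[OF ne]) (use LR that in auto)
  have th01: "0 \<le> \<theta>" "\<theta> \<le> 1" using up[of 0] lo[of 1] by (auto simp: L_def R_def)
  have "(1 - \<theta>) * u a + \<theta> * w a \<ge> 0" if a: "a \<in> A" for a
  proof -
    consider "u a < 0" | "w a < 0" | "u a \<ge> 0" "w a \<ge> 0" by linarith
    thus ?thesis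
    proof cases
      case 1
      hence "u a / (u a - w a) \<le> \<theta>" using a by (intro up) (auto simp: L_def)
      moreover have "w a \<ge> 0" using alt[OF a] 1 by auto
      ultimately show ?thesis using 1 by (simp add: field_simps)
    next
      case 2
      hence "\<theta> \<le> u a / (u a - w a)" using a by (intro lo) (auto simp: R_def)
      moreover have "u a \<ge> 0" using alt[OF a] 2 by auto
      ultimately show ?thesis using 2 by (simp add: field_simps)
    next
      case 3 thus ?thesis using th01 by simp
    qed
  qed
  thus ?thesis using th01 by (intro bexI[of _ \<theta>]) auto
qed

text \<open>Ky Fan's substitute for convexity: strategies carry no linear structure, so averaging is
  demanded of the payoffs only. One \<open>c\<close> has to serve all opponents \<open>b\<close>,
  and the weight \<theta> sits on the second strategy.\<close>

definition convexlike :: "('a \<Rightarrow> 'b \<Rightarrow> real) \<Rightarrow> 'a set \<Rightarrow> 'b set \<Rightarrow> bool" where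
  "convexlike J A B \<longleftrightarrow> (\<forall>a\<in>A. \<forall>a'\<in>A. \<forall>\<theta>\<in>{0..1}. \<exists>c\<in>A. \<forall>b\<in>B.
     J c b \<le> (1 - \<theta>) * J a b + \<theta> * J a' b)"

definition concavelike :: "('a \<Rightarrow> 'b \<Rightarrow> real) \<Rightarrow> 'a set \<Rightarrow> 'b set \<Rightarrow> bool" where
  "concavelike J A B \<longleftrightarrow> (\<forall>b\<in>B. \<forall>b'\<in>B. \<forall>\<theta>\<in>{0..1}. \<exists>c\<in>B. \<forall>a\<in>A.
     (1 - \<theta>) * J a b + \<theta> * J a b' \<le> J a c)"

lemma convexlikeD:
  assumes "convexlike J A B" "a \<in> A" "a' \<in> A" "0 \<le> \<theta>" "\<theta> \<le> 1"
  obtains c where "c \<in> A" "\<And>b. b \<in> B \<Longrightarrow> J c b \<le> (1 - \<theta>) * J a b + \<theta> * J a' b"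
  using assms unfolding convexlike_def by (meson atLeastAtMost_iff)

lemma concavelikeD:
  assumes "concavelike J A B" "b \<in> B" "b' \<in> B" "0 \<le> \<theta>" "\<theta> \<le> 1"
  obtains c where "c \<in> B" "\<And>a. a \<in> A \<Longrightarrow> (1 - \<theta>) * J a b + \<theta> * J a b' \<le> J a c"
  using assms unfolding concavelike_def by (meson atLeastAtMost_iff)

text \<open>Restricting the minimizer to such a set is how the induction over opponents discards
  \<open>b0\<close>. A mixture of two members stays below \<open>v\<close> against
  \<open>b0\<close>, so the property survives.\<close>

lemma convexlike_sublevel:
  assumes "convexlike J A B" "b0 \<in> B"
  shows "convexlike J {a \<in> A. J a b0 < v} B"
  unfolding convexlike_def
proof (intro ballI)
  fix a a' and \<theta> :: real
  assume *: "a \<in> {a \<in> A. J a b0 < v}" "a' \<in> {a \<in> A. J a b0 < v}" "\<theta> \<in> {0..1}"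
  obtain c where c: "c \<in> A" "\<And>b. b \<in> B \<Longrightarrow> J c b \<le> (1 - \<theta>) * J a b + \<theta> * J a' b"
    using convexlikeD[OF assms(1), of a a' \<theta>] * by auto
  have "J c b0 \<le> (1 - \<theta>) * J a b0 + \<theta> * J a' b0" using c assms(2) by auto
  also have "\<dots> < v"
    by (rule convex_bound_lt) (use * in auto)
  finally show "\<exists>c\<in>{a \<in> A. J a b0 < v}. \<forall>b\<in>B. J c b \<le> (1 - \<theta>) * J a b + \<theta> * J a' b"
    using c by blast
qed

text \<open>Induction on the number of opponents. On the part \<open>A0\<close> where
  \<open>b0\<close> does badly, the remaining opponents suffice and yield a single
  \<open>b1\<close>; off \<open>A0\<close> already \<open>b0\<close> is good.
  \<open>two_function_alternative\<close> finds one weight between \<open>b0\<close> and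
  \<open>b1\<close> that works everywhere, and \<open>concavelike\<close> turns it into one
  opponent.\<close>

lemma convexlike_concavelike_finite:
  assumes "finite F" "F \<noteq> {}" "F \<subseteq> B" "convexlike J A B" "concavelike J A B"
    and "\<And>a. a \<in> A \<Longrightarrow> \<exists>b\<in>F. v \<le> J a b" and "v' < v"
  shows "\<exists>b\<in>B. \<forall>a\<in>A. v' \<le> J a b"
  using assms
proof (induction F arbitrary: A v v' rule: finite_ne_induct)
  case (singleton b)
  thus ?case by force
next
  case (insert b0 F)
  obtain v'' where v'': "v' < v''" "v'' < v" using dense insert.prems by blast
  define A0 where "A0 = {a \<in> A. J a b0 < v''}"
  have b0: "b0 \<in> B" using insert.prems by auto
  have "\<exists>b\<in>B. \<forall>a\<in>A0. v'' \<le> J a b"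
  proof (rule insert.IH)
    show "F \<subseteq> B" using insert.prems by auto
    show "convexlike J A0 B"
      unfolding A0_def by (rule convexlike_sublevel) (use insert.prems b0 in auto)
    show "concavelike J A0 B"
      unfolding concavelike_def
    proof (intro ballI)
      fix b b' and \<theta> :: real assume *: "b \<in> B" "b' \<in> B" "\<theta> \<in> {0..1}"
      obtain c where "c \<in> B" "\<And>a. a \<in> A \<Longrightarrow> (1 - \<theta>) * J a b + \<theta> * J a b' \<le> J a c"
        using concavelikeD[OF insert.prems(3), of b b' \<theta>] * by auto
      thus "\<exists>c\<in>B. \<forall>a\<in>A0. (1 - \<theta>) * J a b + \<theta> * J a b' \<le> J a c"
        unfolding A0_def by blast
    qed
    \<comment> \<open>Against a member of \<open>A0\<close> the opponent promised by the hypothesis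
      cannot be \<open>b0\<close>, since \<open>v'' < v\<close>.\<close>
    show "\<exists>b\<in>F. v \<le> J a b" if "a \<in> A0" for a
      using insert.prems(4)[of a] that v'' unfolding A0_def by auto
    show "v'' < v" by fact
  qed
  then obtain b1 where b1: "b1 \<in> B" "\<And>a. a \<in> A0 \<Longrightarrow> v'' \<le> J a b1" by blast
  have "\<exists>\<theta>\<in>{0..1}. \<forall>a\<in>A. (1 - \<theta>) * (J a b0 - v'') + \<theta> * (J a b1 - v'') \<ge> 0"
  proof (rule two_function_alternative)
    fix a a' and \<theta> :: real assume a: "a \<in> A" "a' \<in> A" "0 \<le> \<theta>" "\<theta> \<le> 1"
    obtain c where c: "c \<in> A" "\<And>b. b \<in> B \<Longrightarrow> J c b \<le> (1 - \<theta>) * J a b + \<theta> * J a' b"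
      using convexlikeD[OF insert.prems(2) a] by auto
    show "\<exists>c\<in>A. J c b0 - v'' \<le> (1 - \<theta>) * (J a b0 - v'') + \<theta> * (J a' b0 - v'') \<and>
                J c b1 - v'' \<le> (1 - \<theta>) * (J a b1 - v'') + \<theta> * (J a' b1 - v'')"
      using c(1) c(2)[OF b0] c(2)[OF b1(1)] by (intro bexI[of _ c]) (auto simp: algebra_simps)
  qed (use b1(2) in \<open>force simp: A0_def\<close>)
  then obtain \<theta> where th: "0 \<le> \<theta>" "\<theta> \<le> 1"
    and le: "\<And>a. a \<in> A \<Longrightarrow> (1 - \<theta>) * (J a b0 - v'') + \<theta> * (J a b1 - v'') \<ge> 0" by auto
  obtain c where c: "c \<in> B" "\<And>a. a \<in> A \<Longrightarrow> (1 - \<theta>) * J a b0 + \<theta> * J a b1 \<le> J a c"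
    using concavelikeD[OF insert.prems(3) b0 b1(1) th] by auto
  have "v' \<le> J a c" if "a \<in> A" for a
    using le[OF that] c(2)[OF that] v'' by (simp add: algebra_simps)
  thus ?case using c(1) by blast
qed

text \<open>\<open>q\<close> plays the part of a squared norm and \<open>D\<close> of the matching
  squared distance; \<open>mid\<close> keeps one half of the parallelogram identity. Monotonicity
  does the work of compactness: as \<open>F\<close> grows, \<open>C F\<close> shrinks and the least
  value \<open>d F\<close> rises, but it stays below \<open>Q\<close>. Once \<open>F0\<close> brings
  it within \<eta> of its supremum \<open>R\<close>, one more opponent raises the least value by
  less than \<eta>.\<close>

theorem minimax_uniformly_convex:
  fixes J :: "'a \<Rightarrow> 'b \<Rightarrow> real" and q :: "'a \<Rightarrow> real" and D :: "'a \<Rightarrow> 'a \<Rightarrow> real"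
  assumes conv: "convexlike J A B" and conc: "concavelike J A B" and ne: "A \<noteq> {}"
    and q: "\<And>a. a \<in> A \<Longrightarrow> \<bar>q a\<bar> \<le> Q"
    and mid: "\<And>a a'. a \<in> A \<Longrightarrow> a' \<in> A \<Longrightarrow>
      \<exists>c\<in>A. q c \<le> (q a + q a') / 2 - D a a' / 4 \<and> (\<forall>b\<in>B. J c b \<le> (J a b + J a' b) / 2)"
    and uc: "\<And>\<epsilon>. \<epsilon> > 0 \<Longrightarrow> \<exists>\<delta>>0. \<forall>a\<in>A. \<forall>a'\<in>A. D a a' < \<delta> \<longrightarrow> (\<forall>b\<in>B. J a b \<le> J a' b + \<epsilon>)"
    and v: "\<And>b. b \<in> B \<Longrightarrow> \<exists>a\<in>A. J a b < v" and eps: "\<epsilon> > 0"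
  shows "\<exists>a\<in>A. \<forall>b\<in>B. J a b \<le> v + \<epsilon>"
proof -
  define e where "e = \<epsilon> / 2"
  have e: "e > 0" using eps by (simp add: e_def)
  define C where "C F = {a \<in> A. \<forall>b\<in>F. J a b \<le> v + e}" for F
  \<comment> \<open>If \<open>C F\<close> were empty, every \<open>a\<close> would meet in
    \<open>F\<close> an opponent worth more than \<open>v + e\<close>. The finite minimax would then
    give one \<open>b\<close> worth at least \<open>v\<close> against every \<open>a\<close>,
    contrary to the hypothesis \<open>v\<close>.\<close>
  have Cne: "C F \<noteq> {}" if F: "finite F" "F \<subseteq> B" for F
  proof (cases "F = {}")
    case False
    show ?thesis
    proof
      assume "C F = {}"
      hence "\<exists>b\<in>F. v + e \<le> J a b" if "a \<in> A" for a
        using that unfolding C_def by fastforce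
      hence "\<exists>b\<in>B. \<forall>a\<in>A. v \<le> J a b"
        using convexlike_concavelike_finite[OF F(1) False F(2) conv conc, of "v + e" v] e by auto
      thus False using v by force
    qed
  qed (use ne in \<open>auto simp: C_def\<close>)
  have bb: "bdd_below (q ` C F)" for F
    by (rule bdd_belowI[of _ "- Q"]) (use q in \<open>force simp: C_def\<close>)
  define d where "d F = Inf (q ` C F)" for F
  define \<F> where "\<F> = {F. finite F \<and> F \<subseteq> B}"
  have dle: "d F \<le> q a" if "a \<in> C F" for F a
    unfolding d_def by (rule cInf_lower) (use that bb in auto)
  have ba: "bdd_above (d ` \<F>)"
  proof (rule bdd_aboveI[of _ Q])
    fix x assume "x \<in> d ` \<F>"
    then obtain F where F: "x = d F" "finite F" "F \<subseteq> B" by (auto simp: \<F>_def)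
    obtain a where a: "a \<in> C F" using Cne F by auto
    have "d F \<le> q a" by (rule dle[OF a])
    also have "q a \<le> Q" using q[of a] a by (auto simp: C_def)
    finally show "x \<le> Q" using F by simp
  qed
  define R where "R = Sup (d ` \<F>)"
  obtain \<delta> where \<delta>: "\<delta> > 0"
    and uc': "\<And>a a' b. a \<in> A \<Longrightarrow> a' \<in> A \<Longrightarrow> D a a' < \<delta> \<Longrightarrow> b \<in> B \<Longrightarrow> J a b \<le> J a' b + e"
    using uc[OF e] by blast
  \<comment> \<open>The midpoint of the two near-minimizers used below lies in \<open>C F0\<close>,
    so its \<open>q\<close> exceeds \<open>R - \<eta>\<close>, while theirs are below
    \<open>R + \<eta>\<close>; \<open>mid\<close> then gives
    \<open>D a0 a' < 8 * \<eta>\<close>.\<close>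
  define \<eta> where "\<eta> = \<delta> / 8"
  have \<eta>: "\<eta> > 0" using \<delta> by (simp add: \<eta>_def)
  have "\<exists>F\<in>\<F>. R - \<eta> < d F"
    using less_cSup_iff[OF _ ba, of "R - \<eta>"] \<eta> by (auto simp: R_def \<F>_def)
  then obtain F0 where F0: "finite F0" "F0 \<subseteq> B" "R - \<eta> < d F0" by (auto simp: \<F>_def)
  have near: "\<exists>a\<in>C F. q a < R + \<eta>" if F: "finite F" "F \<subseteq> B" for F
  proof -
    have "d F \<le> R"
      unfolding R_def by (rule cSup_upper[OF _ ba]) (use F in \<open>auto simp: \<F>_def\<close>)
    hence "Inf (q ` C F) < R + \<eta>" using \<eta> by (simp add: d_def)
    thus ?thesis using cInf_less_iff[of "q ` C F" "R + \<eta>"] Cne[OF F] bb by auto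
  qed
  obtain a0 where a0: "a0 \<in> C F0" "q a0 < R + \<eta>" using near F0 by blast
  have "J a0 b \<le> v + \<epsilon>" if b: "b \<in> B" for b
  proof -
    \<comment> \<open>A member of \<open>C (insert b F0)\<close> is good against \<open>b\<close>
      and also lies in \<open>C F0\<close>, which is what keeps its midpoint with \<open>a0\<close>
      in \<open>C F0\<close>.\<close>
    obtain a' where a': "a' \<in> C (insert b F0)" "q a' < R + \<eta>" using near[of "insert b F0"] F0 b by auto
    have AA: "a0 \<in> A" "a' \<in> A" using a0 a' by (auto simp: C_def)
    obtain c where c: "c \<in> A" "q c \<le> (q a0 + q a') / 2 - D a0 a' / 4"
      "\<And>b. b \<in> B \<Longrightarrow> J c b \<le> (J a0 b + J a' b) / 2" using mid[OF AA] by blast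
    have "J c b' \<le> v + e" if "b' \<in> F0" for b'
    proof -
      have "J a0 b' \<le> v + e" "J a' b' \<le> v + e" "b' \<in> B"
        using a0 a' that F0 by (auto simp: C_def)
      thus ?thesis using c(3)[OF \<open>b' \<in> B\<close>] by (simp add: field_simps)
    qed
    hence "c \<in> C F0" using c(1) by (auto simp: C_def)
    hence "R - \<eta> < q c" using dle[of c F0] F0 by auto
    hence "D a0 a' < \<delta>" using c(2) a0(2) a'(2) unfolding \<eta>_def by (simp add: field_simps)
    hence "J a0 b \<le> J a' b + e" using uc' AA b by blast
    also have "J a' b \<le> v + e" using a' by (auto simp: C_def)
    finally show ?thesis by (simp add: e_def)
  qed
  thus ?thesis using a0 by (auto simp: C_def)
qed

section \<open>Rounding to a time grid\<close>

text \<open>The grid starts at \<open>t\<close> with mesh \<open>1 / n\<close>. The cap puts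
  \<open>T\<close> on it even when \<open>T - t\<close> is not a multiple of the mesh.\<close>

definition round_up :: "real \<Rightarrow> real \<Rightarrow> nat \<Rightarrow> real \<Rightarrow> real" where
  "round_up t T n s = min T (t + of_int \<lceil>(s - t) * real n\<rceil> / real n)"

context
  fixes t T :: real and n :: nat
  assumes n: "n > 0"
begin

lemma round_up_ge: "s \<le> T \<Longrightarrow> s \<le> round_up t T n s"
proof -
  have "(s - t) * real n \<le> of_int \<lceil>(s - t) * real n\<rceil>" by (rule le_of_int_ceiling)
  hence "s - t \<le> of_int \<lceil>(s - t) * real n\<rceil> / real n" using n by (simp add: pos_le_divide_eq)
  thus "s \<le> T \<Longrightarrow> ?thesis" by (simp add: round_up_def)
qed

lemma round_up_le: "round_up t T n s \<le> s + 1 / real n"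
proof -
  have "of_int \<lceil>(s - t) * real n\<rceil> \<le> (s - t) * real n + 1" by (rule of_int_ceiling_le_add_one)
  hence "of_int \<lceil>(s - t) * real n\<rceil> / real n \<le> ((s - t) * real n + 1) / real n"
    by (intro divide_right_mono) auto
  also have "\<dots> = s - t + 1 / real n" using n by (simp add: add_divide_distrib)
  finally have "of_int \<lceil>(s - t) * real n\<rceil> / real n \<le> s - t + 1 / real n" .
  thus ?thesis by (simp add: round_up_def)
qed

lemma round_up_le_horizon: "round_up t T n s \<le> T"
  by (simp add: round_up_def)

lemma round_up_mono: "s \<le> s' \<Longrightarrow> round_up t T n s \<le> round_up t T n s'"
  using n unfolding round_up_def
  by (intro min.mono order_refl add_left_mono divide_right_mono)
     (simp_all add: ceiling_mono mult_right_mono)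

lemma round_up_idem: "round_up t T n (round_up t T n s) = round_up t T n s"
proof (cases "t + of_int \<lceil>(s - t) * real n\<rceil> / real n \<le> T")
  case True
  thus ?thesis using n by (simp add: round_up_def)
next
  case False
  have "T \<le> round_up t T n T" by (rule round_up_ge) simp
  thus ?thesis using False by (simp add: round_up_def)
qed

text \<open>For adaptedness: the rounded time has passed by \<open>s\<close> exactly when the
  original one has passed by the last uncapped grid point up to \<open>s\<close>. From
  \<open>T\<close> on the cap makes the left side always true, hence \<open>s < T\<close>.\<close>

lemma round_up_le_iff:
  assumes "s < T"
  shows "round_up t T n x \<le> s \<longleftrightarrow> x \<le> t + of_int \<lfloor>(s - t) * real n\<rfloor> / real n"
proof -
  have "round_up t T n x \<le> s \<longleftrightarrow> of_int \<lceil>(x - t) * real n\<rceil> \<le> (s - t) * real n"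
    using n assms by (auto simp: round_up_def min_le_iff_disj field_simps)
  also have "\<dots> \<longleftrightarrow> \<lceil>(x - t) * real n\<rceil> \<le> \<lfloor>(s - t) * real n\<rfloor>"
    by (simp add: le_floor_iff)
  also have "\<dots> \<longleftrightarrow> x \<le> t + of_int \<lfloor>(s - t) * real n\<rfloor> / real n"
    using n by (simp add: ceiling_le_iff field_simps)
  finally show ?thesis .
qed

lemma finite_round_up: "finite (round_up t T n ` {t..T})"
proof -
  have "round_up t T n ` {t..T} \<subseteq> (\<lambda>k. min T (t + of_int k / real n)) ` {0..\<lceil>(T - t) * real n\<rceil>}"
  proof
    fix y assume "y \<in> round_up t T n ` {t..T}"
    then obtain s where s: "s \<in> {t..T}" "y = round_up t T n s" by auto
    have "\<lceil>(s - t) * real n\<rceil> \<le> \<lceil>(T - t) * real n\<rceil>"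
      using s by (intro ceiling_mono mult_right_mono) auto
    moreover have "0 \<le> \<lceil>(s - t) * real n\<rceil>" 
    proof -
      have "0 \<le> (s - t) * real n" using s by simp
      from ceiling_mono[OF this] show ?thesis by simp
    qed
    ultimately show "y \<in> (\<lambda>k. min T (t + of_int k / real n)) ` {0..\<lceil>(T - t) * real n\<rceil>}"
      using s by (auto simp: round_up_def)
  qed
  thus ?thesis by (rule finite_subset) simp
qed

end

lemma round_up_LIMSEQ:
  assumes "s \<le> T"
  shows "(\<lambda>n. round_up t T (Suc n) s) \<longlonglongrightarrow> s"
proof (rule tendsto_sandwich[where f = "\<lambda>_. s" and h = "\<lambda>n. s + 1 / real (Suc n)"])
  show "(\<lambda>n. s + 1 / real (Suc n)) \<longlonglongrightarrow> s"
    using tendsto_add[OF tendsto_const LIMSEQ_inverse_real_of_nat, of s]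
    by (simp add: inverse_eq_divide)
  show "\<forall>\<^sub>F n in sequentially. s \<le> round_up t T (Suc n) s"
    by (intro always_eventually allI round_up_ge assms) simp
  show "\<forall>\<^sub>F n in sequentially. round_up t T (Suc n) s \<le> s + 1 / real (Suc n)"
    by (intro always_eventually allI round_up_le) simp
qed (rule tendsto_const)

lemma round_up_measurable [measurable]: "round_up t T n \<in> borel_measurable borel"
  unfolding round_up_def by measurable

text \<open>Against an opponent who stops on the grid, stopping at the next grid point costs at most the
  oscillation \<open>w\<close>: at a common grid point the domination \<open>f \<le> g \<le> h\<close> points the right way for
  whichever player is rounded.\<close>

lemma stopped_payoff_round_up_maximizer:
  assumes n: "n > 0" and m: "m \<in> {t..T}" "round_up t T n m = m" and s: "s \<in> {t..T}"
    and w: "\<And>s s'. s \<in> {t..T} \<Longrightarrow> s' \<in> {t..T} \<Longrightarrow> \<bar>s - s'\<bar> \<le> 1 / n \<Longrightarrow> \<bar>f s (y s) - f s' (y s')\<bar> \<le> w"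
    and fh: "\<And>s. s \<in> {t..T} \<Longrightarrow> f s (y s) \<le> h s (y s)" and fg: "f T (y T) \<le> g (y T)"
  shows "stopped_payoff T f h g y m s \<le> stopped_payoff T f h g y m (round_up t T n s) + w"
proof -
  let ?s = "round_up t T n s"
  have le: "s \<le> ?s" "?s \<le> T" "?s \<le> s + 1 / n"
    using round_up_ge[OF n] round_up_le[OF n] round_up_le_horizon[OF n] s by auto
  have r: "?s \<in> {t..T}" "\<bar>s - ?s\<bar> \<le> 1 / n" using le s by auto
  have wf: "f s (y s) \<le> f ?s (y ?s) + w" and w0: "0 \<le> w"
    using w[OF s r] by auto
  consider "s < m" | "m \<le> s" by linarith
  thus ?thesis
  proof cases
    case 1
    hence "?s \<le> m" using round_up_mono[OF n, of s m t T] m by auto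
    then consider "?s < m" | "?s = m" "m < T" | "?s = T" "m = T"
      using m by fastforce
    thus ?thesis
    proof cases
      case 1
      thus ?thesis using wf \<open>s < m\<close> m by (simp add: stopped_payoff_def)
    next
      case 2
      thus ?thesis using wf \<open>s < m\<close> fh[OF r(1)] by (simp add: stopped_payoff_def)
    next
      case 3
      thus ?thesis using wf \<open>s < m\<close> fg by (simp add: stopped_payoff_def)
    qed
  next
    \<comment> \<open>The minimizer acts first or at the same moment, so delaying \<open>s\<close>
      leaves the payoff unchanged.\<close>
    case 2
    thus ?thesis using w0 m s le by (auto simp: stopped_payoff_def)
  qed
qed

text \<open>The letters exchange roles: \<open>s\<close> is now the minimizer's time. Ties before
  \<open>T\<close> are paid as \<open>h\<close>, so landing on \<open>m\<close> there still costs
  \<open>h\<close>. Only arrival at \<open>T\<close> turns \<open>h\<close> into \<open>g\<close>,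
  and there \<open>g \<le> h\<close> helps the minimizer.\<close>

lemma stopped_payoff_round_up_minimizer:
  assumes n: "n > 0" and m: "m \<in> {t..T}" "round_up t T n m = m" and s: "s \<in> {t..T}"
    and w: "\<And>s s'. s \<in> {t..T} \<Longrightarrow> s' \<in> {t..T} \<Longrightarrow> \<bar>s - s'\<bar> \<le> 1 / n \<Longrightarrow> \<bar>h s (y s) - h s' (y s')\<bar> \<le> w"
    and gh: "g (y T) \<le> h T (y T)"
  shows "stopped_payoff T f h g y (round_up t T n s) m \<le> stopped_payoff T f h g y s m + w"
proof -
  let ?s = "round_up t T n s"
  have le: "s \<le> ?s" "?s \<le> T" "?s \<le> s + 1 / n"
    using round_up_ge[OF n] round_up_le[OF n] round_up_le_horizon[OF n] s by auto
  have r: "?s \<in> {t..T}" "\<bar>s - ?s\<bar> \<le> 1 / n" using le s by auto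
  have wh: "h ?s (y ?s) \<le> h s (y s) + w" and w0: "0 \<le> w"
    using w[OF s r] by auto
  consider "m < s" | "s \<le> m" by linarith
  thus ?thesis
  proof cases
    case 1
    thus ?thesis using w0 s le by (auto simp: stopped_payoff_def)
  next
    case 2
    hence "?s \<le> m" using round_up_mono[OF n, of s m t T] m by auto
    moreover have "m \<le> T" "s \<le> T" using m s by auto
    ultimately consider "?s < T" "s < T" | "?s = T" "m = T" "s < T" | "?s = T" "m = T" "s = T"
      using le by linarith
    thus ?thesis
    proof cases
      case 1
      thus ?thesis using wh 2 \<open>?s \<le> m\<close> by (simp add: stopped_payoff_def)
    next
      case 2
      thus ?thesis using wh gh by (simp add: stopped_payoff_def)
    next
      case 3
      thus ?thesis using w0 by (simp add: stopped_payoff_def)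
    qed
  qed
qed

lemma stopped_payoff_bound:
  assumes "\<And>s. s \<in> {t..T} \<Longrightarrow> \<bar>f s (y s)\<bar> \<le> C" "\<And>s. s \<in> {t..T} \<Longrightarrow> \<bar>h s (y s)\<bar> \<le> C" "\<bar>g (y T)\<bar> \<le> C"
    and "m \<in> {t..T}" "s \<in> {t..T}"
  shows "\<bar>stopped_payoff T f h g y m s\<bar> \<le> C"
proof -
  have "0 \<le> C" using assms(3) by linarith
  thus ?thesis using assms by (auto simp: stopped_payoff_def of_bool_def)
qed

section \<open>Randomization and path oscillation\<close>

lemma space_unit_measure [simp]: "space unit_measure = {0..1}"
  by (simp add: unit_measure_def space_restrict_space)

lemma prob_space_unit_measure: "prob_space unit_measure"
  by standard (simp add: unit_measure_def emeasure_restrict_space space_restrict_space)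

lemma measure_unit_measure: "A \<subseteq> {0..1} \<Longrightarrow> measure unit_measure A = measure lborel A"
  unfolding unit_measure_def by (subst measure_restrict_space) auto

lemma measurable_unit_measure_restrict:
  "f \<in> borel \<rightarrow>\<^sub>M borel \<Longrightarrow> (\<And>x. x \<in> {0..1} \<Longrightarrow> f x \<in> {0..1}) \<Longrightarrow> f \<in> unit_measure \<rightarrow>\<^sub>M unit_measure"
  unfolding unit_measure_def
  by (intro measurable_restrict_space2 measurable_restrict_space1) (auto simp: space_restrict_space)

lemma sets_unit_measure_pred:
  assumes "Measurable.pred unit_measure p"
  shows "{r \<in> {0..1}. p r} \<in> sets borel"
proof -
  have "{r \<in> space unit_measure. p r} \<in> sets unit_measure"
    using assms by (rule predE)
  thus ?thesis by (simp add: unit_measure_def sets_restrict_space_iff)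
qed

text \<open>Both endpoint conventions are wanted because \<open>mix_strategy\<close> cuts the unit
  interval into a half-open and a closed piece, each replaying [0, 1] at scale
  \<open>c\<close>.\<close>

lemma measure_lborel_affine_piece:
  fixes a c :: real
  assumes c: "c > 0" and p: "Measurable.pred unit_measure p"
  shows "measure lborel {r \<in> {a..<a + c}. p ((r - a) / c)} = c * measure unit_measure {r \<in> {0..1}. p r}"
    and "measure lborel {r \<in> {a..a + c}. p ((r - a) / c)} = c * measure unit_measure {r \<in> {0..1}. p r}"
    and "{r \<in> {a..<a + c}. p ((r - a) / c)} \<in> sets borel"
    and "{r \<in> {a..a + c}. p ((r - a) / c)} \<in> sets borel"
proof -
  let ?S = "{r \<in> {0..1}. p r}"
  have S [measurable]: "?S \<in> sets borel" by (rule sets_unit_measure_pred[OF p])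
  have eq: "{r \<in> {a..a + c}. p ((r - a) / c)} = (\<lambda>r. (r - a) / c) -` ?S"
    using c by (auto simp: pos_le_divide_eq pos_divide_le_eq)
  have "(\<lambda>r. (r - a) / c) -` ?S \<inter> space borel \<in> sets borel"
    by (rule measurable_sets[OF _ S]) measurable
  thus S1 [measurable]: "{r \<in> {a..a + c}. p ((r - a) / c)} \<in> sets borel" unfolding eq by simp
  have eq2: "{r \<in> {a..<a + c}. p ((r - a) / c)} = {r \<in> {a..a + c}. p ((r - a) / c)} - {a + c}" by auto
  show S2 [measurable]: "{r \<in> {a..<a + c}. p ((r - a) / c)} \<in> sets borel"
    unfolding eq2 by (intro sets.Diff S1) simp
  have "measure lborel {r \<in> {a..a + c}. p ((r - a) / c)}
      = (\<integral>r. indicator {r \<in> {a..a + c}. p ((r - a) / c)} r \<partial>lborel)" by simp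
  also have "\<dots> = c * (\<integral>r. indicator {r \<in> {a..a + c}. p ((r - a) / c)} (a + c * r) \<partial>lborel)"
    using c by (subst lborel_integral_real_affine[of c _ a]) auto
  also have "(\<lambda>r. indicator {r \<in> {a..a + c}. p ((r - a) / c)} (a + c * r) :: real) = indicator ?S"
    using c by (auto simp: fun_eq_iff indicator_def zero_le_mult_iff)
  also have "(\<integral>r. indicator ?S r \<partial>lborel) = measure lborel ?S" by simp
  finally show 1: "measure lborel {r \<in> {a..a + c}. p ((r - a) / c)} = c * measure unit_measure ?S"
    by (subst measure_unit_measure) auto
  have "measure lborel {r \<in> {a..<a + c}. p ((r - a) / c)} = measure lborel {r \<in> {a..a + c}. p ((r - a) / c)}"
    using AE_lborel_singleton[of "a + c"] S1 S2 by (intro measure_eq_AE) auto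
  thus "measure lborel {r \<in> {a..<a + c}. p ((r - a) / c)} = c * measure unit_measure ?S"
    using 1 by simp
qed

text \<open>The coin deciding between \<open>\<mu>\<close> and \<open>\<mu>'\<close> and the one fed to the chosen strategy are read off the
  same uniform \<open>r\<close>.\<close>

definition mix_strategy ::
    "real \<Rightarrow> (real \<Rightarrow> 'w \<Rightarrow> real) \<Rightarrow> (real \<Rightarrow> 'w \<Rightarrow> real) \<Rightarrow> real \<Rightarrow> 'w \<Rightarrow> real" where
  "mix_strategy \<theta> \<mu> \<mu>' r = (if r < \<theta> then \<mu> (r / \<theta>) else \<mu>' ((r - \<theta>) / (1 - \<theta>)))"

lemma mix_argument:
  assumes "\<theta> \<in> {0..1}" "r \<in> {0..1 :: real}"
  shows "r < \<theta> \<Longrightarrow> r / \<theta> \<in> {0..1}" "\<not> r < \<theta> \<Longrightarrow> (r - \<theta>) / (1 - \<theta>) \<in> {0..1}"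
  using assms by (auto simp: divide_simps)

definition stop_prob :: "(real \<Rightarrow> 'w \<Rightarrow> real) \<Rightarrow> real \<Rightarrow> 'w \<Rightarrow> real" where
  "stop_prob \<mu> k w = measure unit_measure {r \<in> {0..1}. \<mu> r w = k}"

lemma stop_prob_mix_strategy:
  assumes th: "\<theta> \<in> {0..1}"
    and m: "(\<lambda>r. \<mu> r w) \<in> borel_measurable unit_measure" "(\<lambda>r. \<mu>' r w) \<in> borel_measurable unit_measure"
  shows "stop_prob (mix_strategy \<theta> \<mu> \<mu>') k w = \<theta> * stop_prob \<mu> k w + (1 - \<theta>) * stop_prob \<mu>' k w"
proof -
  define A where "A = {r \<in> {0..<\<theta>}. \<mu> (r / \<theta>) w = k}"
  define B where "B = {r \<in> {\<theta>..1}. \<mu>' ((r - \<theta>) / (1 - \<theta>)) w = k}"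
  have p: "Measurable.pred unit_measure (\<lambda>r. \<mu> r w = k)" "Measurable.pred unit_measure (\<lambda>r. \<mu>' r w = k)"
    using m by measurable
  have A: "A \<in> sets borel \<and> measure lborel A = \<theta> * stop_prob \<mu> k w"
  proof (cases "\<theta> = 0")
    case False
    thus ?thesis using measure_lborel_affine_piece(1,3)[OF _ p(1), of \<theta> 0] th
      by (simp add: A_def stop_prob_def)
  qed (simp add: A_def)
  have B: "B \<in> sets borel \<and> measure lborel B = (1 - \<theta>) * stop_prob \<mu>' k w"
  proof (cases "\<theta> = 1")
    case True
    \<comment> \<open>The second branch now lives on the single point 1, where division by zero
      feeds 0 to the second strategy. Whether or not that stops at \<open>k\<close>, the piece is
      null.\<close>
    hence "B = {} \<or> B = {1}" by (auto simp: B_def)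
    thus ?thesis using True by auto
  next
    case False
    thus ?thesis using measure_lborel_affine_piece(2,4)[OF _ p(2), of "1 - \<theta>" \<theta>] th
      by (simp add: B_def stop_prob_def)
  qed
  have fin: "emeasure lborel A \<noteq> \<infinity>" "emeasure lborel B \<noteq> \<infinity>"
    using emeasure_mono[of A "{0..1}" lborel] emeasure_mono[of B "{0..1}" lborel] th
    by (auto simp: A_def B_def top_unique subset_iff)
  have "stop_prob (mix_strategy \<theta> \<mu> \<mu>') k w
      = measure lborel {r \<in> {0..1}. mix_strategy \<theta> \<mu> \<mu>' r w = k}"
    unfolding stop_prob_def by (rule measure_unit_measure) auto
  also have "{r \<in> {0..1}. mix_strategy \<theta> \<mu> \<mu>' r w = k} = A \<union> B"
    using th by (auto simp: A_def B_def mix_strategy_def)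
  also have "measure lborel \<dots> = measure lborel A + measure lborel B"
    using A B fin by (intro measure_Union) (auto simp: A_def B_def)
  finally show ?thesis using A B by simp
qed

lemma stop_prob_bounds: "0 \<le> stop_prob \<mu> k w" "stop_prob \<mu> k w \<le> 1"
  using prob_space.prob_le_1[OF prob_space_unit_measure] by (auto simp: stop_prob_def)

lemma mix_strategy_measurable:
  assumes th: "\<theta> \<in> {0..1}"
    and m [measurable]: "(\<lambda>(r, w). \<mu> r w) \<in> borel_measurable (unit_measure \<Otimes>\<^sub>M N)"
      "(\<lambda>(r, w). \<mu>' r w) \<in> borel_measurable (unit_measure \<Otimes>\<^sub>M N)"
  shows "(\<lambda>(r, w). mix_strategy \<theta> \<mu> \<mu>' r w) \<in> borel_measurable (unit_measure \<Otimes>\<^sub>M N)"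
proof -
  have id: "(\<lambda>x. x) \<in> unit_measure \<rightarrow>\<^sub>M borel"
    unfolding unit_measure_def by (intro measurable_restrict_space1) simp
  \<comment> \<open>The clamps are inactive in the branch that is taken; they make both arguments
    measurable maps of all of [0, 1] into itself, before the case distinction.\<close>
  have 1 [measurable]: "(\<lambda>r. min 1 (r / \<theta>)) \<in> unit_measure \<rightarrow>\<^sub>M unit_measure"
    by (rule measurable_unit_measure_restrict) (use th in auto)
  have 2 [measurable]: "(\<lambda>r. max 0 ((r - \<theta>) / (1 - \<theta>))) \<in> unit_measure \<rightarrow>\<^sub>M unit_measure"
    by (rule measurable_unit_measure_restrict) (use th in \<open>auto simp: divide_simps\<close>)
  have 3 [measurable]: "Measurable.pred unit_measure (\<lambda>r. r < \<theta>)"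
    using id by measurable
  have "(\<lambda>x. if fst x < \<theta> then (\<lambda>(r, w). \<mu> r w) (min 1 (fst x / \<theta>), snd x)
      else (\<lambda>(r, w). \<mu>' r w) (max 0 ((fst x - \<theta>) / (1 - \<theta>)), snd x))
      \<in> borel_measurable (unit_measure \<Otimes>\<^sub>M N)"
    by measurable
  also have "?this \<longleftrightarrow> ?thesis"
    using th mix_argument[OF th]
    by (intro measurable_cong) (auto simp: space_pair_measure mix_strategy_def min_def max_def)
  finally show ?thesis .
qed

text \<open>With the time rounded to the grid there are finitely many values, and the composition is
  measurable on each piece; continuity in \<open>s\<close> passes to the limit. The separate space
  \<open>N\<close> allows \<tau> to depend on the players' coins as well, with \<pi> projecting to
  the path.\<close>

lemma caratheodory_measurable_compose:
  fixes Y :: "real \<Rightarrow> 'w \<Rightarrow> real"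
  assumes cont: "\<And>\<omega>. \<omega> \<in> space M \<Longrightarrow> continuous_on {t..T} (\<lambda>s. Y s \<omega>)"
    and Y: "\<And>s. s \<in> {t..T} \<Longrightarrow> Y s \<in> borel_measurable M"
    and \<tau>: "\<tau> \<in> borel_measurable N" "\<And>z. z \<in> space N \<Longrightarrow> \<tau> z \<in> {t..T}"
    and \<pi>: "\<pi> \<in> N \<rightarrow>\<^sub>M M"
  shows "(\<lambda>z. Y (\<tau> z) (\<pi> z)) \<in> borel_measurable N"
proof (rule borel_measurable_LIMSEQ_metric[where f = "\<lambda>n z. Y (round_up t T (Suc n) (\<tau> z)) (\<pi> z)"])
  fix n
  let ?S = "round_up t T (Suc n) ` {t..T}"
  have S: "?S \<subseteq> {t..T}"
    using round_up_ge[of "Suc n" _ T t] round_up_le_horizon by (fastforce intro: order_trans)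
  show "(\<lambda>z. Y (round_up t T (Suc n) (\<tau> z)) (\<pi> z)) \<in> borel_measurable N"
  proof (rule measurable_compose_countable'[where f = "\<lambda>s z. Y s (\<pi> z)"
        and g = "\<lambda>z. round_up t T (Suc n) (\<tau> z)" and I = ?S])
    show "(\<lambda>z. Y s (\<pi> z)) \<in> borel_measurable N" if "s \<in> ?S" for s
      using Y[of s] S that \<pi> by (auto intro: measurable_compose)
    show "(\<lambda>z. round_up t T (Suc n) (\<tau> z)) \<in> N \<rightarrow>\<^sub>M count_space ?S"
    proof (subst measurable_count_space_eq2)
      show "finite ?S" by (rule finite_round_up) simp
      have [measurable]: "(\<lambda>z. round_up t T (Suc n) (\<tau> z)) \<in> borel_measurable N"
        using \<tau>(1) by measurable
      show "(\<lambda>z. round_up t T (Suc n) (\<tau> z)) \<in> space N \<rightarrow> ?S \<and>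
          (\<forall>a\<in>?S. (\<lambda>z. round_up t T (Suc n) (\<tau> z)) -` {a} \<inter> space N \<in> sets N)"
        using \<tau>(2) by (auto intro!: measurable_sets[where A = borel])
    qed
    show "countable ?S" by (intro countable_finite finite_round_up) simp
  qed
next
  fix z assume z: "z \<in> space N"
  have "\<pi> z \<in> space M" using measurable_space[OF \<pi> z] .
  have in_tT: "round_up t T (Suc n) (\<tau> z) \<in> {t..T}" for n
    using round_up_ge[of "Suc n" "\<tau> z" T t] round_up_le_horizon[of "Suc n" t T "\<tau> z"] \<tau>(2)[OF z] by auto
  show "(\<lambda>n. Y (round_up t T (Suc n) (\<tau> z)) (\<pi> z)) \<longlonglongrightarrow> Y (\<tau> z) (\<pi> z)"
    using \<tau>(2)[OF z] in_tT
    by (intro continuous_on_tendsto_compose[OF cont[OF \<open>\<pi> z \<in> space M\<close>] round_up_LIMSEQ]) auto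
qed

text \<open>Requiring the oscillation bound on a countable dense set of pairs makes the event measurable;
  uniform continuity on \<open>{t..T}\<close> makes the events exhaust the space.\<close>

lemma (in prob_space) continuous_process_oscillation:
  fixes Y :: "real \<Rightarrow> 'a \<Rightarrow> real"
  assumes cont: "\<And>\<omega>. \<omega> \<in> space M \<Longrightarrow> continuous_on {t..T} (\<lambda>s. Y s \<omega>)"
    and Y: "\<And>s. s \<in> {t..T} \<Longrightarrow> Y s \<in> borel_measurable M"
    and e: "\<epsilon> > 0"
  shows "\<forall>\<^sub>F n in sequentially. \<exists>A\<in>events. prob (space M - A) < \<epsilon> \<and>
    (\<forall>\<omega>\<in>A. \<forall>s\<in>{t..T}. \<forall>s'\<in>{t..T}. \<bar>s - s'\<bar> \<le> 1 / real (Suc n) \<longrightarrow> \<bar>Y s \<omega> - Y s' \<omega>\<bar> \<le> \<epsilon>)"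
proof -
  define Q where "Q n = {z \<in> {t..T} \<times> {t..T}. \<bar>fst z - snd z\<bar> \<le> 1 / real (Suc n)}" for n
  define A where "A n = {\<omega> \<in> space M. \<forall>z\<in>Q n. \<bar>Y (fst z) \<omega> - Y (snd z) \<omega>\<bar> \<le> \<epsilon>}" for n
  have contQ: "continuous_on (Q n) (\<lambda>z. \<bar>Y (fst z) \<omega> - Y (snd z) \<omega>\<bar>)" if "\<omega> \<in> space M" for n \<omega>
    using cont[OF that] unfolding Q_def
    by (intro continuous_intros continuous_on_compose2[where f = fst] continuous_on_compose2[where f = snd])
       auto
  have "A n \<in> events" for n
  proof -
    obtain D where D: "countable D" "D \<subseteq> Q n" "Q n \<subseteq> closure D" using separable[of "Q n"] by blast
    have "A n = {\<omega> \<in> space M. \<forall>z\<in>D. \<bar>Y (fst z) \<omega> - Y (snd z) \<omega>\<bar> \<le> \<epsilon>}"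
    proof (intro equalityI subsetI)
      fix \<omega> assume "\<omega> \<in> {\<omega> \<in> space M. \<forall>z\<in>D. \<bar>Y (fst z) \<omega> - Y (snd z) \<omega>\<bar> \<le> \<epsilon>}"
      hence \<omega>: "\<omega> \<in> space M" "\<And>z. z \<in> D \<Longrightarrow> \<bar>Y (fst z) \<omega> - Y (snd z) \<omega>\<bar> \<le> \<epsilon>" by auto
      have "\<bar>Y (fst z) \<omega> - Y (snd z) \<omega>\<bar> \<le> \<epsilon>" if z: "z \<in> Q n" for z
      proof -
        obtain x where x: "\<And>k. x k \<in> D" "x \<longlonglongrightarrow> z"
          using D(3) z closure_sequential by blast
        have xQ: "x k \<in> Q n" for k using x(1) D(2) by blast
        have "(\<lambda>k. \<bar>Y (fst (x k)) \<omega> - Y (snd (x k)) \<omega>\<bar>) \<longlonglongrightarrow> \<bar>Y (fst z) \<omega> - Y (snd z) \<omega>\<bar>"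
          by (rule continuous_on_tendsto_compose[OF contQ[OF \<omega>(1)] x(2) z]) (simp add: xQ)
        thus ?thesis using \<omega>(2)[OF x(1)] by (intro LIMSEQ_le_const2) auto
      qed
      thus "\<omega> \<in> A n" using \<omega> by (auto simp: A_def)
    qed (use D in \<open>auto simp: A_def\<close>)
    also have "\<dots> \<in> events"
    proof -
      have "{\<omega> \<in> space M. \<bar>Y (fst z) \<omega> - Y (snd z) \<omega>\<bar> \<le> \<epsilon>} \<in> events" if "z \<in> D" for z
      proof -
        have [measurable]: "Y (fst z) \<in> borel_measurable M" "Y (snd z) \<in> borel_measurable M"
          using that D(2) Y by (auto simp: Q_def)
        show ?thesis by measurable
      qed
      thus ?thesis using D(1) by (intro sets.sets_Collect_countable_All') auto
    qed
    finally show ?thesis .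
  qed
  hence Asets: "range A \<subseteq> events" by auto
  have inc: "incseq A"
  proof (rule incseq_SucI)
    fix n
    have "1 / real (Suc (Suc n)) \<le> 1 / real (Suc n)" by (simp add: frac_le)
    thus "A n \<le> A (Suc n)" unfolding A_def Q_def by auto
  qed
  have un: "(\<Union>n. A n) = space M"
  proof (intro equalityI subsetI)
    fix \<omega> assume \<omega>: "\<omega> \<in> space M"
    have "uniformly_continuous_on {t..T} (\<lambda>s. Y s \<omega>)"
      by (rule compact_uniformly_continuous[OF cont[OF \<omega>]]) simp
    then obtain d where d: "d > 0"
      "\<And>s s'. s \<in> {t..T} \<Longrightarrow> s' \<in> {t..T} \<Longrightarrow> dist s' s < d \<Longrightarrow> dist (Y s' \<omega>) (Y s \<omega>) < \<epsilon>"
      using e unfolding uniformly_continuous_on_def by metis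
    obtain n where n: "1 / real (Suc n) < d"
      using d(1) reals_Archimedean[of d] by (auto simp: inverse_eq_divide)
    have "\<omega> \<in> A n"
      unfolding A_def Q_def using \<omega> d(2) n by (fastforce simp: dist_real_def)
    thus "\<omega> \<in> (\<Union>n. A n)" by auto
  qed (auto simp: A_def)
  have "(\<lambda>n. prob (A n)) \<longlonglongrightarrow> prob (space M)"
    using finite_Lim_measure_incseq[OF Asets inc] un by simp
  hence "\<forall>\<^sub>F n in sequentially. 1 - \<epsilon> < prob (A n)"
    using e by (intro order_tendstoD(1)[of _ 1]) (auto simp: prob_space)
  thus ?thesis
  proof eventually_elim
    case (elim n)
    have "prob (space M - A n) < \<epsilon>" using prob_compl[of "A n"] Asets elim by auto
    thus ?case using Asets by (intro bexI[of _ "A n"]) (auto simp: A_def Q_def)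
  qed
qed

section \<open>Dynkin games with randomized strategies\<close>

text \<open>\<open>N\<close> is what the players observe and \<rho> extracts it from the full
  randomness: costs may depend on all of \<omega>, strategies only on \<open>\<rho> \<omega>\<close>
  and a private coin. No filtration is visible here. Adaptedness is hidden in the abstract set
  \<open>R\<close>, through its containing the constant \<open>T\<close> and its closure under
  mixing and rounding.\<close>

locale dynkin_game = prob_space M for M :: "'w measure" +
  fixes N :: "'v measure" and \<rho> :: "'w \<Rightarrow> 'v" and R :: "(real \<Rightarrow> 'v \<Rightarrow> real) set"
    and t T :: real and X :: "real \<Rightarrow> 'w \<Rightarrow> real ^ 'd::finite"
    and f h :: "'i::finite \<Rightarrow> real \<Rightarrow> real ^ 'd \<Rightarrow> real" and g :: "'i \<Rightarrow> real ^ 'd \<Rightarrow> real"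
    and C :: real and p :: "'i \<Rightarrow> real"
  assumes \<rho> [measurable]: "\<rho> \<in> M \<rightarrow>\<^sub>M N"
    and tT: "t \<le> T"
    and R_measurable: "\<mu> \<in> R \<Longrightarrow> (\<lambda>(r, w). \<mu> r w) \<in> borel_measurable (unit_measure \<Otimes>\<^sub>M N)"
    and R_range: "\<mu> \<in> R \<Longrightarrow> r \<in> {0..1} \<Longrightarrow> w \<in> space N \<Longrightarrow> \<mu> r w \<in> {t..T}"
    and R_const: "(\<lambda>r w. T) \<in> R"
    and R_mix: "\<mu> \<in> R \<Longrightarrow> \<mu>' \<in> R \<Longrightarrow> \<theta> \<in> {0..1} \<Longrightarrow> mix_strategy \<theta> \<mu> \<mu>' \<in> R"
    and R_round: "\<mu> \<in> R \<Longrightarrow> (\<lambda>r w. round_up t T (Suc n) (\<mu> r w)) \<in> R"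
    and f_cont: "\<omega> \<in> space M \<Longrightarrow> continuous_on {t..T} (\<lambda>s. f i s (X s \<omega>))"
    and h_cont: "\<omega> \<in> space M \<Longrightarrow> continuous_on {t..T} (\<lambda>s. h i s (X s \<omega>))"
    and f_meas: "s \<in> {t..T} \<Longrightarrow> (\<lambda>\<omega>. f i s (X s \<omega>)) \<in> borel_measurable M"
    and h_meas: "s \<in> {t..T} \<Longrightarrow> (\<lambda>\<omega>. h i s (X s \<omega>)) \<in> borel_measurable M"
    and g_meas: "(\<lambda>\<omega>. g i (X T \<omega>)) \<in> borel_measurable M"
    and f_bound: "s \<in> {t..T} \<Longrightarrow> \<bar>f i s y\<bar> \<le> C"
    and h_bound: "s \<in> {t..T} \<Longrightarrow> \<bar>h i s y\<bar> \<le> C"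
    and g_bound: "\<bar>g i y\<bar> \<le> C"
    and fh: "s \<in> {t..T} \<Longrightarrow> f i s y \<le> h i s y"
    and fg: "f i T y \<le> g i y" and gh: "g i y \<le> h i T y"
    and p_nonneg: "0 \<le> p i" and p_sum: "(\<Sum>i\<in>UNIV. p i) = 1"
begin

sublocale U: prob_space unit_measure by (rule prob_space_unit_measure)

sublocale UU: pair_prob_space unit_measure unit_measure ..

sublocale W: pair_prob_space M "unit_measure \<Otimes>\<^sub>M unit_measure" ..

section \<open>Expected cost and its stability\<close>

definition cost :: "'i \<Rightarrow> real \<Rightarrow> real \<Rightarrow> 'w \<Rightarrow> real" where
  "cost i m s \<omega> = stopped_payoff T (f i) (h i) (g i) (\<lambda>s. X s \<omega>) m s"

definition expected_cost :: "'i \<Rightarrow> (real \<Rightarrow> 'v \<Rightarrow> real) \<Rightarrow> (real \<Rightarrow> 'v \<Rightarrow> real) \<Rightarrow> real" where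
  "expected_cost i \<mu> \<nu> =
     (LINT (\<omega>, r, q)|(M \<Otimes>\<^sub>M (unit_measure \<Otimes>\<^sub>M unit_measure)). cost i (\<mu> r (\<rho> \<omega>)) (\<nu> q (\<rho> \<omega>)) \<omega>)"

lemma C_nonneg: "0 \<le> C"
  using g_bound[of undefined undefined] by linarith

lemma cost_bound: "m \<in> {t..T} \<Longrightarrow> s \<in> {t..T} \<Longrightarrow> \<bar>cost i m s \<omega>\<bar> \<le> C"
  unfolding cost_def by (rule stopped_payoff_bound[where t = t]) (auto simp: f_bound h_bound g_bound)

lemma cost_measurable:
  assumes "m \<in> borel_measurable K" "s \<in> borel_measurable K"
    and "\<And>z. z \<in> space K \<Longrightarrow> m z \<in> {t..T}" "\<And>z. z \<in> space K \<Longrightarrow> s z \<in> {t..T}"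
    and "\<pi> \<in> K \<rightarrow>\<^sub>M M"
  shows "(\<lambda>z. cost i (m z) (s z) (\<pi> z)) \<in> borel_measurable K"
proof -
  have [measurable]: "(\<lambda>z. f i (s z) (X (s z) (\<pi> z))) \<in> borel_measurable K"
    by (rule caratheodory_measurable_compose[where Y = "\<lambda>s \<omega>. f i s (X s \<omega>)" and t = t and T = T and M = M])
       (use assms f_cont f_meas in auto)
  have [measurable]: "(\<lambda>z. h i (m z) (X (m z) (\<pi> z))) \<in> borel_measurable K"
    by (rule caratheodory_measurable_compose[where Y = "\<lambda>s \<omega>. h i s (X s \<omega>)" and t = t and T = T and M = M])
       (use assms h_cont h_meas in auto)
  have [measurable]: "(\<lambda>z. g i (X T (\<pi> z))) \<in> borel_measurable K"
    by (rule measurable_compose[OF assms(5) g_meas])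
  note [measurable] = assms(1,2)
  show ?thesis unfolding cost_def stopped_payoff_def of_bool_def by measurable
qed

lemma strategy_measurable:
  assumes "\<mu> \<in> R" and a: "a \<in> K \<rightarrow>\<^sub>M unit_measure" and b: "b \<in> K \<rightarrow>\<^sub>M N"
  shows "(\<lambda>z. \<mu> (a z) (b z)) \<in> borel_measurable K"
  using measurable_compose[OF measurable_Pair[OF a b] R_measurable[OF assms(1)]] by simp

lemma integrable_cost:
  assumes "\<mu> \<in> R" "\<nu> \<in> R"
  shows "integrable (M \<Otimes>\<^sub>M (unit_measure \<Otimes>\<^sub>M unit_measure))
           (\<lambda>(\<omega>, r, q). cost i (\<mu> r (\<rho> \<omega>)) (\<nu> q (\<rho> \<omega>)) \<omega>)"
proof (rule W.P.integrable_const_bound[where B = C])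
  let ?W = "M \<Otimes>\<^sub>M (unit_measure \<Otimes>\<^sub>M unit_measure)"
  have rng: "\<mu> (fst (snd z)) (\<rho> (fst z)) \<in> {t..T}" "\<nu> (snd (snd z)) (\<rho> (fst z)) \<in> {t..T}"
    if "z \<in> space ?W" for z
    using that measurable_space[OF \<rho>] by (auto intro!: R_range[OF assms(1)] R_range[OF assms(2)] simp: space_pair_measure simp del: atLeastAtMost_iff)
  show "AE z in ?W. norm (case z of (\<omega>, r, q) \<Rightarrow> cost i (\<mu> r (\<rho> \<omega>)) (\<nu> q (\<rho> \<omega>)) \<omega>) \<le> C"
    using rng cost_bound by (intro AE_I2) (auto simp: case_prod_beta)
  have "(\<lambda>z. cost i (\<mu> (fst (snd z)) (\<rho> (fst z))) (\<nu> (snd (snd z)) (\<rho> (fst z))) (fst z)) \<in> borel_measurable ?W"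
    by (intro cost_measurable strategy_measurable assms rng) measurable
  thus "(\<lambda>(\<omega>, r, q). cost i (\<mu> r (\<rho> \<omega>)) (\<nu> q (\<rho> \<omega>)) \<omega>) \<in> borel_measurable ?W"
    by (simp add: case_prod_beta)
qed

text \<open>On \<open>A\<close> the loss is at most \<delta>. Off \<open>A\<close> two costs bounded
  by \<open>C\<close> differ by at most \<open>2 * C\<close>, on an event of probability at most
  \<delta>. Hence the factor \<open>1 + 2 * C\<close>.\<close>

lemma expected_cost_mono_off_small_set:
  assumes R: "\<mu> \<in> R" "\<nu> \<in> R" "\<mu>' \<in> R" "\<nu>' \<in> R"
    and A: "A \<in> events" "prob (space M - A) \<le> \<delta>"
    and le: "\<And>\<omega> r q. \<omega> \<in> A \<Longrightarrow> \<omega> \<in> space M \<Longrightarrow> r \<in> {0..1} \<Longrightarrow> q \<in> {0..1} \<Longrightarrow>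
      cost i (\<mu> r (\<rho> \<omega>)) (\<nu> q (\<rho> \<omega>)) \<omega> \<le> cost i (\<mu>' r (\<rho> \<omega>)) (\<nu>' q (\<rho> \<omega>)) \<omega> + \<delta>"
  shows "expected_cost i \<mu> \<nu> \<le> expected_cost i \<mu>' \<nu>' + (1 + 2 * C) * \<delta>"
proof -
  let ?U = "unit_measure \<Otimes>\<^sub>M unit_measure"
  let ?W = "M \<Otimes>\<^sub>M ?U"
  let ?F = "\<lambda>\<mu> \<nu> z. case z of (\<omega>, r, q) \<Rightarrow> cost i (\<mu> r (\<rho> \<omega>)) (\<nu> q (\<rho> \<omega>)) \<omega>"
  let ?B = "(space M - A) \<times> space ?U"
  have d: "0 \<le> \<delta>" using A(2) measure_nonneg order_trans by blast
  have B: "?B \<in> sets ?W" using A(1) by auto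
  have mB: "measure ?W ?B = prob (space M - A)"
    unfolding measure_def using A(1)
    by (subst UU.P.emeasure_pair_measure_Times) (auto simp: UU.P.emeasure_space_1)
  have iB: "integrable ?W (indicator ?B :: _ \<Rightarrow> real)"
    using B by (simp add: W.P.emeasure_eq_measure)
  have "expected_cost i \<mu> \<nu> \<le> (\<integral>z. ?F \<mu>' \<nu>' z + (\<delta> + 2 * C * indicator ?B z) \<partial>?W)"
    unfolding expected_cost_def
  proof (rule integral_mono)
    show "integrable ?W (?F \<mu> \<nu>)" by (rule integrable_cost[OF R(1,2)])
    show "integrable ?W (\<lambda>z. ?F \<mu>' \<nu>' z + (\<delta> + 2 * C * indicator ?B z))"
      by (intro Bochner_Integration.integrable_add integrable_cost[OF R(3,4)] integrable_mult_right iB) auto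
    fix z assume z: "z \<in> space ?W"
    obtain \<omega> r q where zz: "z = (\<omega>, r, q)" by (cases z) auto
    have sp: "\<omega> \<in> space M" "r \<in> {0..1}" "q \<in> {0..1}" using z by (auto simp: zz space_pair_measure)
    have w: "\<rho> \<omega> \<in> space N" using measurable_space[OF \<rho> sp(1)] .
    show "?F \<mu> \<nu> z \<le> ?F \<mu>' \<nu>' z + (\<delta> + 2 * C * indicator ?B z)"
    proof (cases "\<omega> \<in> A")
      case True
      thus ?thesis using le[OF True sp] by (simp add: zz)
    next
      case False
      have "\<bar>?F \<mu> \<nu> z\<bar> \<le> C" "\<bar>?F \<mu>' \<nu>' z\<bar> \<le> C"
        
        using cost_bound[OF R_range[OF R(1) sp(2) w] R_range[OF R(2) sp(3) w]]
          cost_bound[OF R_range[OF R(3) sp(2) w] R_range[OF R(4) sp(3) w]] by (auto simp: zz)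
      moreover have "indicator ?B z = (1::real)" using False sp by (simp add: zz space_pair_measure)
      ultimately show ?thesis using d by simp
    qed
  qed
  also have "\<dots> = expected_cost i \<mu>' \<nu>' + (\<delta> + 2 * C * prob (space M - A))"
    using integrable_cost[OF R(3,4)] iB B mB
    by (simp add: expected_cost_def W.P.prob_space)
  also have "\<dots> \<le> expected_cost i \<mu>' \<nu>' + (1 + 2 * C) * \<delta>"
    using mult_left_mono[OF A(2), of "2 * C"] C_nonneg by (simp add: algebra_simps)
  finally show ?thesis .
qed

section \<open>Grid strategies and the price of rounding\<close>

definition round_strategy :: "nat \<Rightarrow> (real \<Rightarrow> 'v \<Rightarrow> real) \<Rightarrow> real \<Rightarrow> 'v \<Rightarrow> real" where
  "round_strategy n \<mu> r w = round_up t T (Suc n) (\<mu> r w)"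

text \<open>Being on the grid is encoded as being fixed by rounding, the form in which the pointwise
  rounding lemmas ask for it. \<open>grid_strategies_range\<close> turns this into membership in the
  finite set \<open>grid n\<close>.\<close>

definition grid_strategies :: "nat \<Rightarrow> (real \<Rightarrow> 'v \<Rightarrow> real) set" where
  "grid_strategies n =
     {\<mu> \<in> R. \<forall>r\<in>{0..1}. \<forall>w\<in>space N. round_up t T (Suc n) (\<mu> r w) = \<mu> r w}"

lemma round_strategy_in_R: "\<mu> \<in> R \<Longrightarrow> round_strategy n \<mu> \<in> R"
  using R_round[of \<mu> n] by (simp add: round_strategy_def[abs_def])

lemma round_strategy_grid: "\<mu> \<in> R \<Longrightarrow> round_strategy n \<mu> \<in> grid_strategies n"
  unfolding grid_strategies_def
  by (simp add: round_strategy_in_R) (simp add: round_strategy_def round_up_idem)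

lemma grid_strategies_subset: "grid_strategies n \<subseteq> R"
  by (auto simp: grid_strategies_def)

lemma mix_strategy_grid:
  assumes "\<mu> \<in> grid_strategies n" "\<mu>' \<in> grid_strategies n" "\<theta> \<in> {0..1}"
  shows "mix_strategy \<theta> \<mu> \<mu>' \<in> grid_strategies n"
  using assms mix_argument[OF assms(3)] R_mix[OF _ _ assms(3), of \<mu> \<mu>']
  by (auto simp: grid_strategies_def mix_strategy_def simp del: atLeastAtMost_iff)

text \<open>How large \<open>n\<close> must be is read off the oscillation of \<open>f\<close> and
  \<open>h\<close> along the state process, before any strategy is chosen; this makes the estimate
  uniform. There are finitely many indices \<open>i\<close>, so one \<open>n\<close> serves them
  all.\<close>

lemma rounding_costs_little:
  assumes e: "\<epsilon> > 0"
  shows "\<forall>\<^sub>F n in sequentially. \<forall>i. \<forall>\<mu>\<in>grid_strategies n. \<forall>\<nu>\<in>R.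
    expected_cost i \<mu> \<nu> \<le> expected_cost i \<mu> (round_strategy n \<nu>) + \<epsilon> \<and>
    expected_cost i (round_strategy n \<nu>) \<mu> \<le> expected_cost i \<nu> \<mu> + \<epsilon>"
proof -
  define \<delta> where "\<delta> = \<epsilon> / (1 + 2 * C)"
  have \<delta>: "\<delta> > 0" and \<delta>': "(1 + 2 * C) * \<delta> = \<epsilon>" using e C_nonneg by (simp_all add: \<delta>_def)
  have ev: "\<forall>\<^sub>F n in sequentially. \<forall>\<mu>\<in>grid_strategies n. \<forall>\<nu>\<in>R.
    expected_cost i \<mu> \<nu> \<le> expected_cost i \<mu> (round_strategy n \<nu>) + \<epsilon> \<and>
    expected_cost i (round_strategy n \<nu>) \<mu> \<le> expected_cost i \<nu> \<mu> + \<epsilon>" for i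
  proof -
    \<comment> \<open>This event for \<open>f\<close> pays for rounding the maximizer, the next one
      for \<open>h\<close> for rounding the minimizer.\<close>
    have "\<forall>\<^sub>F n in sequentially. \<exists>A\<in>events. prob (space M - A) < \<delta> \<and>
      (\<forall>\<omega>\<in>A. \<forall>s\<in>{t..T}. \<forall>s'\<in>{t..T}. \<bar>s - s'\<bar> \<le> 1 / real (Suc n) \<longrightarrow>
        \<bar>f i s (X s \<omega>) - f i s' (X s' \<omega>)\<bar> \<le> \<delta>)"
      by (rule continuous_process_oscillation[where Y = "\<lambda>s \<omega>. f i s (X s \<omega>)"])
         (fact f_cont f_meas \<delta>)+
    moreover have "\<forall>\<^sub>F n in sequentially. \<exists>A\<in>events. prob (space M - A) < \<delta> \<and>
      (\<forall>\<omega>\<in>A. \<forall>s\<in>{t..T}. \<forall>s'\<in>{t..T}. \<bar>s - s'\<bar> \<le> 1 / real (Suc n) \<longrightarrow>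
        \<bar>h i s (X s \<omega>) - h i s' (X s' \<omega>)\<bar> \<le> \<delta>)"
      by (rule continuous_process_oscillation[where Y = "\<lambda>s \<omega>. h i s (X s \<omega>)"])
         (fact h_cont h_meas \<delta>)+
    ultimately show ?thesis
    proof eventually_elim
      case (elim n)
      obtain A where A: "A \<in> events" "prob (space M - A) < \<delta>"
        "\<And>\<omega> s s'. \<omega> \<in> A \<Longrightarrow> s \<in> {t..T} \<Longrightarrow> s' \<in> {t..T} \<Longrightarrow> \<bar>s - s'\<bar> \<le> 1 / real (Suc n) \<Longrightarrow>
          \<bar>f i s (X s \<omega>) - f i s' (X s' \<omega>)\<bar> \<le> \<delta>" using elim(1) by blast
      obtain A' where A': "A' \<in> events" "prob (space M - A') < \<delta>"
        "\<And>\<omega> s s'. \<omega> \<in> A' \<Longrightarrow> s \<in> {t..T} \<Longrightarrow> s' \<in> {t..T} \<Longrightarrow> \<bar>s - s'\<bar> \<le> 1 / real (Suc n) \<Longrightarrow>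
          \<bar>h i s (X s \<omega>) - h i s' (X s' \<omega>)\<bar> \<le> \<delta>" using elim(2) by blast
      show ?case
      proof (intro ballI conjI)
        fix \<mu> \<nu> assume *: "\<mu> \<in> grid_strategies n" "\<nu> \<in> R"
        have \<mu>: "\<mu> \<in> R" and \<mu>g: "\<And>r w. r \<in> {0..1} \<Longrightarrow> w \<in> space N \<Longrightarrow> round_up t T (Suc n) (\<mu> r w) = \<mu> r w"
          using * by (auto simp: grid_strategies_def)
        have "expected_cost i \<mu> \<nu> \<le> expected_cost i \<mu> (round_strategy n \<nu>) + (1 + 2 * C) * \<delta>"
        proof (rule expected_cost_mono_off_small_set[OF \<mu> *(2) \<mu> round_strategy_in_R[OF *(2)] A(1)])
          fix \<omega> r q assume z: "\<omega> \<in> A" "\<omega> \<in> space M" "r \<in> {0..1::real}" "q \<in> {0..1::real}"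
          have w: "\<rho> \<omega> \<in> space N" using measurable_space[OF \<rho> z(2)] .
          show "cost i (\<mu> r (\<rho> \<omega>)) (\<nu> q (\<rho> \<omega>)) \<omega>
              \<le> cost i (\<mu> r (\<rho> \<omega>)) (round_strategy n \<nu> q (\<rho> \<omega>)) \<omega> + \<delta>"
            unfolding cost_def round_strategy_def
            by (rule stopped_payoff_round_up_maximizer[OF zero_less_Suc R_range[OF \<mu> z(3) w]
                  \<mu>g[OF z(3) w] R_range[OF *(2) z(4) w]])
               (rule fg | erule fh | erule (2) A(3)[OF z(1)])+
        qed (use A in auto)
        thus "expected_cost i \<mu> \<nu> \<le> expected_cost i \<mu> (round_strategy n \<nu>) + \<epsilon>" by (simp add: \<delta>')
        have "expected_cost i (round_strategy n \<nu>) \<mu> \<le> expected_cost i \<nu> \<mu> + (1 + 2 * C) * \<delta>"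
        proof (rule expected_cost_mono_off_small_set[OF round_strategy_in_R[OF *(2)] \<mu> *(2) \<mu> A'(1)])
          fix \<omega> r q assume z: "\<omega> \<in> A'" "\<omega> \<in> space M" "r \<in> {0..1::real}" "q \<in> {0..1::real}"
          have w: "\<rho> \<omega> \<in> space N" using measurable_space[OF \<rho> z(2)] .
          show "cost i (round_strategy n \<nu> r (\<rho> \<omega>)) (\<mu> q (\<rho> \<omega>)) \<omega>
              \<le> cost i (\<nu> r (\<rho> \<omega>)) (\<mu> q (\<rho> \<omega>)) \<omega> + \<delta>"
            unfolding cost_def round_strategy_def
            by (rule stopped_payoff_round_up_minimizer[OF zero_less_Suc R_range[OF \<mu> z(4) w]
                  \<mu>g[OF z(4) w] R_range[OF *(2) z(3) w]])
               (rule gh | erule (2) A'(3)[OF z(1)])+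
        qed (use A' in auto)
        thus "expected_cost i (round_strategy n \<nu>) \<mu> \<le> expected_cost i \<nu> \<mu> + \<epsilon>" by (simp add: \<delta>')
      qed
    qed
  qed
  have "\<forall>\<^sub>F n in sequentially. \<forall>i\<in>UNIV. \<forall>\<mu>\<in>grid_strategies n. \<forall>\<nu>\<in>R.
    expected_cost i \<mu> \<nu> \<le> expected_cost i \<mu> (round_strategy n \<nu>) + \<epsilon> \<and>
    expected_cost i (round_strategy n \<nu>) \<mu> \<le> expected_cost i \<nu> \<mu> + \<epsilon>"
    using ev by (intro eventually_ball_finite) auto
  thus ?thesis by simp
qed

section \<open>Bilinear form of the cost on the grid\<close>

definition grid :: "nat \<Rightarrow> real set" where
  "grid n = round_up t T (Suc n) ` {t..T}"

lemma finite_grid: "finite (grid n)"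
  unfolding grid_def by (rule finite_round_up) simp

lemma grid_subset: "grid n \<subseteq> {t..T}"
proof
  fix k assume "k \<in> grid n"
  then obtain s where s: "s \<in> {t..T}" "k = round_up t T (Suc n) s" by (auto simp: grid_def)
  thus "k \<in> {t..T}"
    using round_up_ge[of "Suc n" s T t] round_up_le_horizon[of "Suc n" t T s] by auto
qed

lemma grid_strategies_range:
  assumes "\<mu> \<in> grid_strategies n" "r \<in> {0..1}" "w \<in> space N"
  shows "\<mu> r w \<in> grid n"
proof -
  have "\<mu> r w \<in> {t..T}" "round_up t T (Suc n) (\<mu> r w) = \<mu> r w"
    using R_range[OF _ assms(2,3)] assms by (auto simp: grid_strategies_def)
  thus ?thesis unfolding grid_def by (metis image_eqI)
qed

lemma stop_prob_eq_integral:
  "stop_prob \<mu> k w = (\<integral>r. of_bool (\<mu> r w = k) \<partial>unit_measure)"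
proof -
  have "(\<lambda>r. of_bool (\<mu> r w = k) :: real) = indicator {r. \<mu> r w = k}"
    by (auto simp: fun_eq_iff indicator_def)
  thus ?thesis
    by (simp add: stop_prob_def Int_def conj_commute)
qed

lemma stop_prob_measurable:
  assumes "\<mu> \<in> R"
  shows "(\<lambda>\<omega>. stop_prob \<mu> k (\<rho> \<omega>)) \<in> borel_measurable M"
proof -
  have [measurable]: "(\<lambda>z. \<mu> (snd z) (\<rho> (fst z))) \<in> borel_measurable (M \<Otimes>\<^sub>M unit_measure)"
    by (rule strategy_measurable[OF assms]) measurable
  show ?thesis
    unfolding stop_prob_eq_integral of_bool_def
    by (intro U.borel_measurable_lebesgue_integral) (simp add: case_prod_beta)
qed

lemma cost_measurable_const: "m \<in> {t..T} \<Longrightarrow> s \<in> {t..T} \<Longrightarrow> cost i m s \<in> borel_measurable M"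
  by (rule cost_measurable[where m = "\<lambda>_. m" and s = "\<lambda>_. s" and \<pi> = "\<lambda>\<omega>. \<omega>", simplified]) auto

text \<open>Given the path, the two coins are independent, so the joint conditional law of the two
  stopping times is the product of the laws given by \<open>stop_prob\<close>. Finiteness of the
  grid turns the integral over the coins into a double sum.\<close>

lemma expected_cost_grid:
  assumes "\<mu> \<in> grid_strategies n" "\<nu> \<in> grid_strategies n"
  shows "expected_cost i \<mu> \<nu> = (\<Sum>k\<in>grid n. \<Sum>l\<in>grid n.
    \<integral>\<omega>. cost i k l \<omega> * stop_prob \<mu> k (\<rho> \<omega>) * stop_prob \<nu> l (\<rho> \<omega>) \<partial>M)"
proof -
  let ?U = "unit_measure \<Otimes>\<^sub>M unit_measure"
  let ?W = "M \<Otimes>\<^sub>M ?U"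
  have R: "\<mu> \<in> R" "\<nu> \<in> R" using assms grid_strategies_subset by auto
  define F :: "real \<Rightarrow> real \<Rightarrow> 'w \<times> real \<times> real \<Rightarrow> real"
    where "F k l = (\<lambda>(\<omega>, r, q). cost i k l \<omega> * (of_bool (\<mu> r (\<rho> \<omega>) = k) * of_bool (\<nu> q (\<rho> \<omega>) = l)))" for k l
  have [measurable]: "(\<lambda>z. \<mu> (fst (snd z)) (\<rho> (fst z))) \<in> borel_measurable ?W"
      "(\<lambda>z. \<nu> (snd (snd z)) (\<rho> (fst z))) \<in> borel_measurable ?W"
    by (rule strategy_measurable[OF R(1)], measurable) (rule strategy_measurable[OF R(2)], measurable)
  have F_int: "integrable ?W (F k l)" if "k \<in> grid n" "l \<in> grid n" for k l
  proof (rule W.P.integrable_const_bound[where B = C])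
    have kl: "k \<in> {t..T}" "l \<in> {t..T}" using subsetD[OF grid_subset] that by blast+
    note [measurable] = cost_measurable_const[OF kl]
    show "F k l \<in> borel_measurable ?W"
      unfolding F_def case_prod_beta of_bool_def by measurable
    show "AE z in ?W. norm (F k l z) \<le> C"
      using cost_bound[OF kl] C_nonneg by (intro AE_I2) (auto simp: F_def case_prod_beta)
  qed
  have "expected_cost i \<mu> \<nu> = (\<integral>z. (\<Sum>k\<in>grid n. \<Sum>l\<in>grid n. F k l z) \<partial>?W)"
    unfolding expected_cost_def
  proof (rule Bochner_Integration.integral_cong)
    fix z assume z: "z \<in> space ?W"
    obtain \<omega> r q where zz: "z = (\<omega>, r, q)" by (cases z) auto
    have sp: "\<omega> \<in> space M" "r \<in> {0..1}" "q \<in> {0..1}" using z by (auto simp: zz space_pair_measure)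
    have w: "\<rho> \<omega> \<in> space N" using measurable_space[OF \<rho> sp(1)] .
    have gr: "\<mu> r (\<rho> \<omega>) \<in> grid n" "\<nu> q (\<rho> \<omega>) \<in> grid n"
      using grid_strategies_range assms sp w by auto
    \<comment> \<open>For given path and coins exactly one pair of grid points survives, so both
      sums collapse.\<close>
    have row: "(\<Sum>l\<in>grid n. F k l z) = cost i k (\<nu> q (\<rho> \<omega>)) \<omega> * of_bool (\<mu> r (\<rho> \<omega>) = k)" for k
      using gr(2) finite_grid
      by (simp add: zz F_def of_bool_def if_distrib cong: if_cong)
    have "(\<Sum>k\<in>grid n. \<Sum>l\<in>grid n. F k l z)
        = (\<Sum>k\<in>grid n. cost i k (\<nu> q (\<rho> \<omega>)) \<omega> * of_bool (\<mu> r (\<rho> \<omega>) = k))"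
      by (intro sum.cong refl row)
    also have "\<dots> = cost i (\<mu> r (\<rho> \<omega>)) (\<nu> q (\<rho> \<omega>)) \<omega>"
      using gr(1) finite_grid by (simp add: of_bool_def if_distrib cong: if_cong)
    finally show "(case z of (\<omega>, r, q) \<Rightarrow> cost i (\<mu> r (\<rho> \<omega>)) (\<nu> q (\<rho> \<omega>)) \<omega>)
        = (\<Sum>k\<in>grid n. \<Sum>l\<in>grid n. F k l z)" by (simp add: zz)
  qed simp
  also have "\<dots> = (\<Sum>k\<in>grid n. (\<integral>z. (\<Sum>l\<in>grid n. F k l z) \<partial>?W))"
    by (intro Bochner_Integration.integral_sum Bochner_Integration.integrable_sum F_int)
  also have "\<dots> = (\<Sum>k\<in>grid n. \<Sum>l\<in>grid n. (\<integral>z. F k l z \<partial>?W))"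
    by (intro sum.cong refl Bochner_Integration.integral_sum F_int)
  also have "\<dots> = (\<Sum>k\<in>grid n. \<Sum>l\<in>grid n.
      \<integral>\<omega>. cost i k l \<omega> * stop_prob \<mu> k (\<rho> \<omega>) * stop_prob \<nu> l (\<rho> \<omega>) \<partial>M)"
  proof (intro sum.cong refl)
    fix k l assume kl: "k \<in> grid n" "l \<in> grid n"
    \<comment> \<open>The path is frozen and only the coins are integrated; Fubini splits the
      product of indicators.\<close>
    have inner: "(\<integral>y. F k l (\<omega>, y) \<partial>?U) = cost i k l \<omega> * stop_prob \<mu> k (\<rho> \<omega>) * stop_prob \<nu> l (\<rho> \<omega>)"
      if \<omega>: "\<omega> \<in> space M" for \<omega>
    proof -
      have w: "\<rho> \<omega> \<in> space N" using measurable_space[OF \<rho> \<omega>] .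
      have [measurable]: "(\<lambda>z. \<mu> (fst z) (\<rho> \<omega>)) \<in> borel_measurable ?U"
          "(\<lambda>z. \<nu> (snd z) (\<rho> \<omega>)) \<in> borel_measurable ?U"
        by (rule strategy_measurable[OF R(1) measurable_fst measurable_const[OF w]],
            rule strategy_measurable[OF R(2) measurable_snd measurable_const[OF w]])
      have I: "integrable ?U (\<lambda>(r, q). of_bool (\<mu> r (\<rho> \<omega>) = k) * of_bool (\<nu> q (\<rho> \<omega>) = l) :: real)"
      proof (rule UU.P.integrable_const_bound[where B = 1])
        show "(\<lambda>(r, q). of_bool (\<mu> r (\<rho> \<omega>) = k) * of_bool (\<nu> q (\<rho> \<omega>) = l) :: real) \<in> borel_measurable ?U"
          unfolding case_prod_beta' of_bool_def by measurable
      qed (simp add: case_prod_beta)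
      have "(\<integral>y. F k l (\<omega>, y) \<partial>?U)
          = cost i k l \<omega> * (\<integral>(r, q). of_bool (\<mu> r (\<rho> \<omega>) = k) * of_bool (\<nu> q (\<rho> \<omega>) = l) \<partial>?U)"
        by (simp add: F_def case_prod_beta')
      also have "(\<integral>(r, q). of_bool (\<mu> r (\<rho> \<omega>) = k) * of_bool (\<nu> q (\<rho> \<omega>) = l) \<partial>?U)
          = stop_prob \<mu> k (\<rho> \<omega>) * stop_prob \<nu> l (\<rho> \<omega>)"
        using UU.integral_fst'[OF I] by (simp add: stop_prob_eq_integral)
      finally show ?thesis by (simp add: mult.assoc)
    qed
    have "(\<integral>z. F k l z \<partial>?W) = (\<integral>\<omega>. (\<integral>y. F k l (\<omega>, y) \<partial>?U) \<partial>M)"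
      using W.integral_fst'[OF F_int[OF kl]] by simp
    also have "\<dots> = (\<integral>\<omega>. cost i k l \<omega> * stop_prob \<mu> k (\<rho> \<omega>) * stop_prob \<nu> l (\<rho> \<omega>) \<partial>M)"
      by (intro Bochner_Integration.integral_cong inner) auto
    finally show "(\<integral>z. F k l z \<partial>?W)
        = (\<integral>\<omega>. cost i k l \<omega> * stop_prob \<mu> k (\<rho> \<omega>) * stop_prob \<nu> l (\<rho> \<omega>) \<partial>M)" .
  qed
  finally show ?thesis .
qed

lemma integrable_cost_term:
  assumes "\<mu> \<in> R" "\<nu> \<in> R" "k \<in> grid n" "l \<in> grid n"
  shows "integrable M (\<lambda>\<omega>. cost i k l \<omega> * stop_prob \<mu> k (\<rho> \<omega>) * stop_prob \<nu> l (\<rho> \<omega>))"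
proof (rule integrable_const_bound[where B = C])
  have kl: "k \<in> {t..T}" "l \<in> {t..T}" using subsetD[OF grid_subset] assms by blast+
  note [measurable] = cost_measurable_const[OF kl] stop_prob_measurable[OF assms(1)] stop_prob_measurable[OF assms(2)]
  show "(\<lambda>\<omega>. cost i k l \<omega> * stop_prob \<mu> k (\<rho> \<omega>) * stop_prob \<nu> l (\<rho> \<omega>)) \<in> borel_measurable M"
    by measurable
  have "\<bar>cost i k l \<omega>\<bar> * stop_prob \<mu> k (\<rho> \<omega>) * stop_prob \<nu> l (\<rho> \<omega>) \<le> C * 1 * 1" for \<omega>
    using C_nonneg stop_prob_bounds by (intro mult_mono cost_bound kl mult_nonneg_nonneg) auto
  thus "AE \<omega> in M. norm (cost i k l \<omega> * stop_prob \<mu> k (\<rho> \<omega>) * stop_prob \<nu> l (\<rho> \<omega>)) \<le> C"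
    by (intro AE_I2) (simp add: abs_mult stop_prob_bounds)
qed

lemma strategy_section_measurable:
  assumes "\<mu> \<in> R" "w \<in> space N"
  shows "(\<lambda>r. \<mu> r w) \<in> borel_measurable unit_measure"
  by (rule strategy_measurable[OF assms(1)]) (use assms in auto)

lemma stop_prob_mix:
  assumes "\<mu> \<in> R" "\<mu>' \<in> R" "\<theta> \<in> {0..1}" "\<omega> \<in> space M"
  shows "stop_prob (mix_strategy \<theta> \<mu> \<mu>') k (\<rho> \<omega>)
    = \<theta> * stop_prob \<mu> k (\<rho> \<omega>) + (1 - \<theta>) * stop_prob \<mu>' k (\<rho> \<omega>)"
  using assms measurable_space[OF \<rho> assms(4)]
  by (intro stop_prob_mix_strategy strategy_section_measurable)

text \<open>The grid formula is linear in each \<open>stop_prob\<close>, and mixing averages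
  \<open>stop_prob\<close> exactly. The resulting equalities give the game both
  \<open>convexlike\<close> and \<open>concavelike\<close>.\<close>

lemma expected_cost_mix:
  assumes "\<mu> \<in> grid_strategies n" "\<mu>' \<in> grid_strategies n" "\<nu> \<in> grid_strategies n" "\<theta> \<in> {0..1}"
  shows "expected_cost i (mix_strategy \<theta> \<mu> \<mu>') \<nu> = \<theta> * expected_cost i \<mu> \<nu> + (1 - \<theta>) * expected_cost i \<mu>' \<nu>"
    and "expected_cost i \<nu> (mix_strategy \<theta> \<mu> \<mu>') = \<theta> * expected_cost i \<nu> \<mu> + (1 - \<theta>) * expected_cost i \<nu> \<mu>'"
proof -
  have R: "\<mu> \<in> R" "\<mu>' \<in> R" "\<nu> \<in> R" using assms grid_strategies_subset by auto
  note mix = mix_strategy_grid[OF assms(1,2,4)]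
  note int = integrable_cost_term[where n = n]
  have "(\<integral>\<omega>. cost i k l \<omega> * stop_prob (mix_strategy \<theta> \<mu> \<mu>') k (\<rho> \<omega>) * stop_prob \<nu> l (\<rho> \<omega>) \<partial>M)
     = \<theta> * (\<integral>\<omega>. cost i k l \<omega> * stop_prob \<mu> k (\<rho> \<omega>) * stop_prob \<nu> l (\<rho> \<omega>) \<partial>M)
       + (1 - \<theta>) * (\<integral>\<omega>. cost i k l \<omega> * stop_prob \<mu>' k (\<rho> \<omega>) * stop_prob \<nu> l (\<rho> \<omega>) \<partial>M)"
    (is "?L = ?R") if kl: "k \<in> grid n" "l \<in> grid n" for k l
  proof -
    have "?L = (\<integral>\<omega>. \<theta> * (cost i k l \<omega> * stop_prob \<mu> k (\<rho> \<omega>) * stop_prob \<nu> l (\<rho> \<omega>))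
        + (1 - \<theta>) * (cost i k l \<omega> * stop_prob \<mu>' k (\<rho> \<omega>) * stop_prob \<nu> l (\<rho> \<omega>)) \<partial>M)"
      by (intro Bochner_Integration.integral_cong)
         (auto simp: stop_prob_mix[OF R(1,2) assms(4)] algebra_simps)
    also have "\<dots> = ?R"
      using int[OF R(1,3) kl, of i] int[OF R(2,3) kl, of i] by simp
    finally show ?thesis .
  qed
  thus "expected_cost i (mix_strategy \<theta> \<mu> \<mu>') \<nu> = \<theta> * expected_cost i \<mu> \<nu> + (1 - \<theta>) * expected_cost i \<mu>' \<nu>"
    by (simp add: expected_cost_grid[OF mix assms(3)] expected_cost_grid[OF assms(1,3)]
        expected_cost_grid[OF assms(2,3)] sum.distrib sum_distrib_left)
  have "(\<integral>\<omega>. cost i k l \<omega> * stop_prob \<nu> k (\<rho> \<omega>) * stop_prob (mix_strategy \<theta> \<mu> \<mu>') l (\<rho> \<omega>) \<partial>M)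
     = \<theta> * (\<integral>\<omega>. cost i k l \<omega> * stop_prob \<nu> k (\<rho> \<omega>) * stop_prob \<mu> l (\<rho> \<omega>) \<partial>M)
       + (1 - \<theta>) * (\<integral>\<omega>. cost i k l \<omega> * stop_prob \<nu> k (\<rho> \<omega>) * stop_prob \<mu>' l (\<rho> \<omega>) \<partial>M)"
    (is "?L = ?R") if kl: "k \<in> grid n" "l \<in> grid n" for k l
  proof -
    have "?L = (\<integral>\<omega>. \<theta> * (cost i k l \<omega> * stop_prob \<nu> k (\<rho> \<omega>) * stop_prob \<mu> l (\<rho> \<omega>))
        + (1 - \<theta>) * (cost i k l \<omega> * stop_prob \<nu> k (\<rho> \<omega>) * stop_prob \<mu>' l (\<rho> \<omega>)) \<partial>M)"
      by (intro Bochner_Integration.integral_cong)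
         (auto simp: stop_prob_mix[OF R(1,2) assms(4)] algebra_simps)
    also have "\<dots> = ?R"
      using int[OF R(3,1) kl, of i] int[OF R(3,2) kl, of i] by simp
    finally show ?thesis .
  qed
  thus "expected_cost i \<nu> (mix_strategy \<theta> \<mu> \<mu>') = \<theta> * expected_cost i \<nu> \<mu> + (1 - \<theta>) * expected_cost i \<nu> \<mu>'"
    by (simp add: expected_cost_grid[OF assms(3) mix] expected_cost_grid[OF assms(3,1)]
        expected_cost_grid[OF assms(3,2)] sum.distrib sum_distrib_left)
qed

section \<open>Hilbert space geometry of the stopping probabilities\<close>

definition stop_dist2 :: "nat \<Rightarrow> (real \<Rightarrow> 'v \<Rightarrow> real) \<Rightarrow> (real \<Rightarrow> 'v \<Rightarrow> real) \<Rightarrow> real" where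
  "stop_dist2 n \<mu> \<mu>' = (\<Sum>k\<in>grid n. \<integral>\<omega>. (stop_prob \<mu> k (\<rho> \<omega>) - stop_prob \<mu>' k (\<rho> \<omega>))\<^sup>2 \<partial>M)"

text \<open>A strategy is represented by the vector of its conditional stopping probabilities in the
  L^2 space of functions with one coordinate per grid point. Strategies with the same conditional
  law are identified: \<open>stop_dist2\<close> vanishes between them.\<close>

definition stop_norm2 :: "nat \<Rightarrow> (real \<Rightarrow> 'v \<Rightarrow> real) \<Rightarrow> real" where
  "stop_norm2 n \<mu> = (\<Sum>k\<in>grid n. \<integral>\<omega>. (stop_prob \<mu> k (\<rho> \<omega>))\<^sup>2 \<partial>M)"

lemma integrable_stop_prob_sq:
  assumes "\<mu> \<in> R" "\<mu>' \<in> R"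
  shows "integrable M (\<lambda>\<omega>. (stop_prob \<mu> k (\<rho> \<omega>))\<^sup>2)"
    and "integrable M (\<lambda>\<omega>. (stop_prob \<mu> k (\<rho> \<omega>) - stop_prob \<mu>' k (\<rho> \<omega>))\<^sup>2)"
proof -
  note [measurable] = stop_prob_measurable[OF assms(1)] stop_prob_measurable[OF assms(2)]
  have b: "\<bar>stop_prob \<mu> k w\<bar> \<le> 1" "\<bar>stop_prob \<mu> k w - stop_prob \<mu>' k w\<bar> \<le> 1" for w
    using stop_prob_bounds[of \<mu> k w] stop_prob_bounds[of \<mu>' k w] by auto
  hence sq: "(stop_prob \<mu> k w)\<^sup>2 \<le> 1" "(stop_prob \<mu> k w - stop_prob \<mu>' k w)\<^sup>2 \<le> 1" for w
    by (simp_all add: abs_square_le_1)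
  show "integrable M (\<lambda>\<omega>. (stop_prob \<mu> k (\<rho> \<omega>))\<^sup>2)"
    by (rule integrable_const_bound[where B = 1]) (simp add: sq, measurable)
  show "integrable M (\<lambda>\<omega>. (stop_prob \<mu> k (\<rho> \<omega>) - stop_prob \<mu>' k (\<rho> \<omega>))\<^sup>2)"
    by (rule integrable_const_bound[where B = 1]) (simp add: sq, measurable)
qed

lemma stop_norm2_bounds:
  assumes "\<mu> \<in> R"
  shows "\<bar>stop_norm2 n \<mu>\<bar> \<le> real (card (grid n))"
proof -
  have "\<bar>\<integral>\<omega>. (stop_prob \<mu> k (\<rho> \<omega>))\<^sup>2 \<partial>M\<bar> \<le> 1" for k
  proof -
    have "(\<integral>\<omega>. (stop_prob \<mu> k (\<rho> \<omega>))\<^sup>2 \<partial>M) \<le> (\<integral>\<omega>. 1 \<partial>M)"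
      by (intro integral_mono power_le_one stop_prob_bounds integrable_stop_prob_sq(1)[OF assms assms]) simp
    moreover have "0 \<le> (\<integral>\<omega>. (stop_prob \<mu> k (\<rho> \<omega>))\<^sup>2 \<partial>M)" by (intro integral_nonneg_AE AE_I2) simp
    ultimately show ?thesis by (simp add: prob_space)
  qed
  hence "\<bar>stop_norm2 n \<mu>\<bar> \<le> (\<Sum>k\<in>grid n. 1)"
    unfolding stop_norm2_def by (intro order_trans[OF sum_abs] sum_mono)
  thus ?thesis by simp
qed

text \<open>Mixing with weight 1/2 averages the conditional laws pointwise, so this is the
  parallelogram identity, integrated and summed over the grid. It supplies \<open>mid\<close> in
  \<open>minimax_uniformly_convex\<close>.\<close>

lemma stop_norm2_midpoint:
  assumes "\<mu> \<in> R" "\<mu>' \<in> R"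
  shows "stop_norm2 n (mix_strategy (1/2) \<mu> \<mu>') = (stop_norm2 n \<mu> + stop_norm2 n \<mu>') / 2 - stop_dist2 n \<mu> \<mu>' / 4"
proof -
  have "(\<integral>\<omega>. (stop_prob (mix_strategy (1/2) \<mu> \<mu>') k (\<rho> \<omega>))\<^sup>2 \<partial>M)
      = ((\<integral>\<omega>. (stop_prob \<mu> k (\<rho> \<omega>))\<^sup>2 \<partial>M) + (\<integral>\<omega>. (stop_prob \<mu>' k (\<rho> \<omega>))\<^sup>2 \<partial>M)) / 2
        - (\<integral>\<omega>. (stop_prob \<mu> k (\<rho> \<omega>) - stop_prob \<mu>' k (\<rho> \<omega>))\<^sup>2 \<partial>M) / 4" (is "?L = ?R") for k
  proof -
    have half: "(1/2::real) \<in> {0..1}" by simp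
    have "?L = (\<integral>\<omega>. ((stop_prob \<mu> k (\<rho> \<omega>))\<^sup>2 + (stop_prob \<mu>' k (\<rho> \<omega>))\<^sup>2) / 2
        - (stop_prob \<mu> k (\<rho> \<omega>) - stop_prob \<mu>' k (\<rho> \<omega>))\<^sup>2 / 4 \<partial>M)"
      by (intro Bochner_Integration.integral_cong)
         (auto simp: stop_prob_mix[OF assms half] power2_eq_square field_simps)
    also have "\<dots> = ?R"
      using integrable_stop_prob_sq[OF assms] integrable_stop_prob_sq[OF assms(2,1)] by simp
    finally show ?thesis .
  qed
  thus ?thesis
    by (simp add: stop_norm2_def stop_dist2_def sum.distrib sum_subtractf flip: sum_divide_distrib)
qed

text \<open>The opponent enters the grid formula through factors between 0 and 1, so an L^2 bound on
  the change of \<mu> controls the cost independently of \<nu>.\<close>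

lemma expected_cost_uniformly_continuous:
  assumes e: "\<epsilon> > 0"
  shows "\<exists>\<delta>>0. \<forall>\<mu>\<in>grid_strategies n. \<forall>\<mu>'\<in>grid_strategies n. stop_dist2 n \<mu> \<mu>' < \<delta> \<longrightarrow>
    (\<forall>\<nu>\<in>grid_strategies n. \<forall>i. expected_cost i \<mu> \<nu> \<le> expected_cost i \<mu>' \<nu> + \<epsilon>)"
proof -
  define c where "c = real (card (grid n))"
  \<comment> \<open>Each of the \<open>c * c\<close> pairs of grid points contributes an error of at
    most \<open>C * \<eta>\<close>; the added 1 keeps the denominator positive.\<close>
  define \<eta> where "\<eta> = \<epsilon> / (c * c * C + 1)"
  have c: "0 \<le> c * c * C" using C_nonneg by (simp add: c_def)
  have \<eta>: "\<eta> > 0" using e c by (simp add: \<eta>_def)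
  show ?thesis
  proof (intro exI[of _ "\<eta>\<^sup>2"] conjI ballI impI allI)
    show "\<eta>\<^sup>2 > 0" using \<eta> by simp
    fix \<mu> \<mu>' \<nu> i
    assume *: "\<mu> \<in> grid_strategies n" "\<mu>' \<in> grid_strategies n" "\<nu> \<in> grid_strategies n"
      and D: "stop_dist2 n \<mu> \<mu>' < \<eta>\<^sup>2"
    have R: "\<mu> \<in> R" "\<mu>' \<in> R" "\<nu> \<in> R" using * grid_strategies_subset by auto
    have D1: "(\<integral>\<omega>. (stop_prob \<mu> k (\<rho> \<omega>) - stop_prob \<mu>' k (\<rho> \<omega>))\<^sup>2 \<partial>M) \<le> \<eta>\<^sup>2" if "k \<in> grid n" for k
    proof -
      have "(\<integral>\<omega>. (stop_prob \<mu> k (\<rho> \<omega>) - stop_prob \<mu>' k (\<rho> \<omega>))\<^sup>2 \<partial>M) \<le> stop_dist2 n \<mu> \<mu>'"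
        unfolding stop_dist2_def
        by (rule member_le_sum[OF that _ finite_grid]) (auto intro!: integral_nonneg_AE AE_I2)
      thus ?thesis using D by simp
    qed
    have summand: "(\<integral>\<omega>. cost i k l \<omega> * stop_prob \<mu> k (\<rho> \<omega>) * stop_prob \<nu> l (\<rho> \<omega>) \<partial>M)
        \<le> (\<integral>\<omega>. cost i k l \<omega> * stop_prob \<mu>' k (\<rho> \<omega>) * stop_prob \<nu> l (\<rho> \<omega>) \<partial>M) + C * \<eta>"
      if kl: "k \<in> grid n" "l \<in> grid n" for k l
    proof -
      have kl': "k \<in> {t..T}" "l \<in> {t..T}" using subsetD[OF grid_subset] kl by blast+
      let ?d = "\<lambda>\<omega>. stop_prob \<mu> k (\<rho> \<omega>) - stop_prob \<mu>' k (\<rho> \<omega>)"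
      have "(\<integral>\<omega>. cost i k l \<omega> * stop_prob \<mu> k (\<rho> \<omega>) * stop_prob \<nu> l (\<rho> \<omega>) \<partial>M)
          \<le> (\<integral>\<omega>. cost i k l \<omega> * stop_prob \<mu>' k (\<rho> \<omega>) * stop_prob \<nu> l (\<rho> \<omega>)
                 + C * (\<eta> / 2 + (?d \<omega>)\<^sup>2 / (2 * \<eta>)) \<partial>M)"
      proof (rule integral_mono)
        fix \<omega>
        \<comment> \<open>Young's inequality with parameter \<eta> stands in for Cauchy-Schwarz:
          once the integral of the square is at most \<open>\<eta>\<^sup>2\<close>, the right side
          of \<open>amgm\<close> integrates to at most \<eta>.\<close>
        have "0 \<le> (\<bar>?d \<omega>\<bar> - \<eta>)\<^sup>2" by simp
        hence "2 * \<eta> * \<bar>?d \<omega>\<bar> \<le> \<eta>\<^sup>2 + (?d \<omega>)\<^sup>2" by (simp add: power2_diff mult_ac)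
        hence amgm: "\<bar>?d \<omega>\<bar> \<le> \<eta> / 2 + (?d \<omega>)\<^sup>2 / (2 * \<eta>)"
          using \<eta> by (simp add: field_simps power2_eq_square)
        have "cost i k l \<omega> * ?d \<omega> * stop_prob \<nu> l (\<rho> \<omega>) \<le> \<bar>cost i k l \<omega>\<bar> * \<bar>?d \<omega>\<bar> * stop_prob \<nu> l (\<rho> \<omega>)"
          using stop_prob_bounds[of \<nu> l] by (intro mult_right_mono) (auto simp flip: abs_mult)
        also have "\<dots> \<le> C * (\<eta> / 2 + (?d \<omega>)\<^sup>2 / (2 * \<eta>)) * 1"
          using stop_prob_bounds[of \<nu> l] C_nonneg \<eta> by (intro mult_mono amgm cost_bound[OF kl']) auto
        finally show "cost i k l \<omega> * stop_prob \<mu> k (\<rho> \<omega>) * stop_prob \<nu> l (\<rho> \<omega>)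
          \<le> cost i k l \<omega> * stop_prob \<mu>' k (\<rho> \<omega>) * stop_prob \<nu> l (\<rho> \<omega>)
                 + C * (\<eta> / 2 + (?d \<omega>)\<^sup>2 / (2 * \<eta>))"
          by (simp add: algebra_simps)
      qed (use integrable_cost_term[OF R(1,3) kl] integrable_cost_term[OF R(2,3) kl]
             integrable_stop_prob_sq[OF R(1,2)] in auto)
      also have "\<dots> = (\<integral>\<omega>. cost i k l \<omega> * stop_prob \<mu>' k (\<rho> \<omega>) * stop_prob \<nu> l (\<rho> \<omega>) \<partial>M)
          + C * (\<eta> / 2 + (\<integral>\<omega>. (?d \<omega>)\<^sup>2 \<partial>M) / (2 * \<eta>))"
        using integrable_cost_term[OF R(2,3) kl] integrable_stop_prob_sq[OF R(1,2)] by (simp add: prob_space)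
      also have "\<dots> \<le> (\<integral>\<omega>. cost i k l \<omega> * stop_prob \<mu>' k (\<rho> \<omega>) * stop_prob \<nu> l (\<rho> \<omega>) \<partial>M)
          + C * (\<eta> / 2 + \<eta>\<^sup>2 / (2 * \<eta>))"
        using D1[OF kl(1)] \<eta> C_nonneg by (intro add_left_mono mult_left_mono divide_right_mono) auto
      also have "\<eta> / 2 + \<eta>\<^sup>2 / (2 * \<eta>) = \<eta>" using \<eta> by (simp add: power2_eq_square)
      finally show ?thesis .
    qed
    have "expected_cost i \<mu> \<nu> \<le> (\<Sum>k\<in>grid n. \<Sum>l\<in>grid n.
      (\<integral>\<omega>. cost i k l \<omega> * stop_prob \<mu>' k (\<rho> \<omega>) * stop_prob \<nu> l (\<rho> \<omega>) \<partial>M) + C * \<eta>)"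
      unfolding expected_cost_grid[OF *(1,3)] by (intro sum_mono summand)
    also have "\<dots> = expected_cost i \<mu>' \<nu> + c * c * C * \<eta>"
      by (simp add: expected_cost_grid[OF *(2,3)] sum.distrib c_def)
    also have "c * c * C * \<eta> \<le> \<epsilon>"
    proof -
      have "c * c * C * \<eta> \<le> (c * c * C + 1) * \<eta>" using \<eta> by simp
      also have "\<dots> = \<epsilon>" using c by (simp add: \<eta>_def)
      finally show ?thesis .
    qed
    finally show "expected_cost i \<mu> \<nu> \<le> expected_cost i \<mu>' \<nu> + \<epsilon>" by simp
  qed
qed

section \<open>Minimax on the grid and the value of the game\<close>

definition total_cost :: "('i \<Rightarrow> real \<Rightarrow> 'v \<Rightarrow> real) \<Rightarrow> (real \<Rightarrow> 'v \<Rightarrow> real) \<Rightarrow> real" where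
  "total_cost \<mu> \<nu> = (\<Sum>i\<in>UNIV. p i * expected_cost i (\<mu> i) \<nu>)"

lemma total_cost_mono:
  assumes "\<And>i. expected_cost i (\<mu> i) \<nu> \<le> expected_cost i (\<mu>' i) \<nu>' + \<epsilon>"
  shows "total_cost \<mu> \<nu> \<le> total_cost \<mu>' \<nu>' + \<epsilon>"
proof -
  have "total_cost \<mu> \<nu> \<le> (\<Sum>i\<in>UNIV. p i * (expected_cost i (\<mu>' i) \<nu>' + \<epsilon>))"
    unfolding total_cost_def by (intro sum_mono mult_left_mono assms p_nonneg)
  also have "\<dots> = total_cost \<mu>' \<nu>' + (\<Sum>i\<in>UNIV. p i) * \<epsilon>"
    by (simp add: total_cost_def distrib_left sum.distrib sum_distrib_right)
  finally show ?thesis by (simp add: p_sum)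
qed

text \<open>The minimizer holds one strategy per index \<open>i\<close>, so the squared norm and
  distance are summed over the indices, and mixtures are formed index by index with a common
  weight.\<close>

lemma grid_minimax:
  assumes v: "\<And>\<nu>. \<nu> \<in> grid_strategies n \<Longrightarrow> \<exists>\<mu>\<in>{\<mu>. \<forall>i. \<mu> i \<in> grid_strategies n}. total_cost \<mu> \<nu> < v"
    and e: "\<epsilon> > 0"
  shows "\<exists>\<mu>\<in>{\<mu>. \<forall>i. \<mu> i \<in> grid_strategies n}. \<forall>\<nu>\<in>grid_strategies n. total_cost \<mu> \<nu> \<le> v + \<epsilon>"
proof -
  let ?B = "grid_strategies n"
  let ?A = "{\<mu>. \<forall>i::'i. \<mu> i \<in> ?B}"
  let ?q = "\<lambda>\<mu>. \<Sum>i\<in>UNIV. stop_norm2 n (\<mu> i)"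
  let ?D = "\<lambda>\<mu> \<mu>'. \<Sum>i\<in>UNIV. stop_dist2 n (\<mu> i) (\<mu>' i)"
  let ?mix = "\<lambda>\<theta> \<mu> \<mu>' i. mix_strategy \<theta> (\<mu> i) (\<mu>' i)"
  have mixA: "total_cost (?mix \<theta> \<mu> \<mu>') \<nu> = \<theta> * total_cost \<mu> \<nu> + (1 - \<theta>) * total_cost \<mu>' \<nu>"
    if "\<mu> \<in> ?A" "\<mu>' \<in> ?A" "\<theta> \<in> {0..1}" "\<nu> \<in> ?B" for \<mu> \<mu>' \<nu> \<theta>
    using that by (simp add: total_cost_def expected_cost_mix[where n = n] sum.distrib sum_subtractf sum_distrib_left algebra_simps)
  have mixA': "?mix \<theta> \<mu> \<mu>' \<in> ?A" if "\<mu> \<in> ?A" "\<mu>' \<in> ?A" "\<theta> \<in> {0..1}" for \<mu> \<mu>' \<theta>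
    using that by (simp add: mix_strategy_grid)
  have mixB: "total_cost \<mu> (mix_strategy \<theta> \<nu> \<nu>') = \<theta> * total_cost \<mu> \<nu> + (1 - \<theta>) * total_cost \<mu> \<nu>'"
    if "\<nu> \<in> ?B" "\<nu>' \<in> ?B" "\<theta> \<in> {0..1}" "\<mu> \<in> ?A" for \<mu> \<nu> \<nu>' \<theta>
    using that by (simp add: total_cost_def expected_cost_mix[where n = n] sum.distrib sum_subtractf sum_distrib_left algebra_simps)
  show ?thesis
  proof (rule minimax_uniformly_convex[where J = total_cost and q = ?q and D = ?D
        and Q = "\<Sum>i\<in>(UNIV::'i set). real (card (grid n))"])
    show "convexlike total_cost ?A ?B"
      unfolding convexlike_def
    proof (intro ballI)
      fix \<mu> \<mu>' and \<theta> :: real assume *: "\<mu> \<in> ?A" "\<mu>' \<in> ?A" "\<theta> \<in> {0..1}"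
      show "\<exists>c\<in>?A. \<forall>\<nu>\<in>?B. total_cost c \<nu> \<le> (1 - \<theta>) * total_cost \<mu> \<nu> + \<theta> * total_cost \<mu>' \<nu>"
      \<comment> \<open>The two strategies are swapped because \<open>mix_strategy\<close> puts
        \<theta> on its first strategy, \<open>convexlike\<close> on its second.\<close>
      proof (rule bexI[OF _ mixA'[OF *(2,1,3)]], rule ballI)
        fix \<nu> assume \<nu>: "\<nu> \<in> ?B"
        show "total_cost (?mix \<theta> \<mu>' \<mu>) \<nu> \<le> (1 - \<theta>) * total_cost \<mu> \<nu> + \<theta> * total_cost \<mu>' \<nu>"
          using mixA[OF *(2,1,3) \<nu>] by linarith
      qed
    qed
    show "concavelike total_cost ?A ?B"
      unfolding concavelike_def
    proof (intro ballI)
      fix \<nu> \<nu>' and \<theta> :: real assume *: "\<nu> \<in> ?B" "\<nu>' \<in> ?B" "\<theta> \<in> {0..1}"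
      show "\<exists>c\<in>?B. \<forall>\<mu>\<in>?A. (1 - \<theta>) * total_cost \<mu> \<nu> + \<theta> * total_cost \<mu> \<nu>' \<le> total_cost \<mu> c"
      proof (rule bexI[OF _ mix_strategy_grid[OF *(2,1,3)]], rule ballI)
        fix \<mu> assume \<mu>: "\<mu> \<in> ?A"
        show "(1 - \<theta>) * total_cost \<mu> \<nu> + \<theta> * total_cost \<mu> \<nu>' \<le> total_cost \<mu> (mix_strategy \<theta> \<nu>' \<nu>)"
          using mixB[OF *(2,1,3) \<mu>] by linarith
      qed
    qed
    have "(\<lambda>_. round_strategy n (\<lambda>r w. T)) \<in> ?A"
      using round_strategy_grid[OF R_const] by simp
    thus "?A \<noteq> {}" by (metis empty_iff)
    show "\<bar>?q \<mu>\<bar> \<le> (\<Sum>i\<in>(UNIV::'i set). real (card (grid n)))" if "\<mu> \<in> ?A" for \<mu>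
      by (intro order_trans[OF sum_abs] sum_mono stop_norm2_bounds subsetD[OF grid_strategies_subset])
         (use that in blast)
    show "\<exists>c\<in>?A. ?q c \<le> (?q \<mu> + ?q \<mu>') / 2 - ?D \<mu> \<mu>' / 4 \<and>
        (\<forall>\<nu>\<in>?B. total_cost c \<nu> \<le> (total_cost \<mu> \<nu> + total_cost \<mu>' \<nu>) / 2)"
      if *: "\<mu> \<in> ?A" "\<mu>' \<in> ?A" for \<mu> \<mu>'
    proof (intro bexI conjI ballI)
      have half: "(1/2::real) \<in> {0..1}" by simp
      show "?mix (1/2) \<mu> \<mu>' \<in> ?A" by (rule mixA'[OF * half])
      have mem: "\<mu> i \<in> R" "\<mu>' i \<in> R" for i using * subsetD[OF grid_strategies_subset] by blast+
      show "?q (?mix (1/2) \<mu> \<mu>') \<le> (?q \<mu> + ?q \<mu>') / 2 - ?D \<mu> \<mu>' / 4"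
        by (simp only: stop_norm2_midpoint[OF mem])
           (simp add: sum.distrib sum_subtractf sum_divide_distrib add_divide_distrib)
      show "total_cost (?mix (1/2) \<mu> \<mu>') \<nu> \<le> (total_cost \<mu> \<nu> + total_cost \<mu>' \<nu>) / 2" if "\<nu> \<in> ?B" for \<nu>
        using mixA[OF * half that] by simp
    qed
    show "\<exists>\<delta>>0. \<forall>\<mu>\<in>?A. \<forall>\<mu>'\<in>?A. ?D \<mu> \<mu>' < \<delta> \<longrightarrow> (\<forall>\<nu>\<in>?B. total_cost \<mu> \<nu> \<le> total_cost \<mu>' \<nu> + \<epsilon>)"
      if "\<epsilon> > 0" for \<epsilon>
    proof -
      obtain \<delta> where \<delta>: "\<delta> > 0" and uc: "\<And>\<mu> \<mu>' \<nu> i. \<mu> \<in> ?B \<Longrightarrow> \<mu>' \<in> ?B \<Longrightarrow> stop_dist2 n \<mu> \<mu>' < \<delta> \<Longrightarrow>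
          \<nu> \<in> ?B \<Longrightarrow> expected_cost i \<mu> \<nu> \<le> expected_cost i \<mu>' \<nu> + \<epsilon>"
        using expected_cost_uniformly_continuous[OF \<open>\<epsilon> > 0\<close>, of n] by blast
      show ?thesis
      proof (intro exI[of _ \<delta>] conjI \<delta> ballI impI)
        fix \<mu> \<mu>' \<nu> assume *: "\<mu> \<in> ?A" "\<mu>' \<in> ?A" "?D \<mu> \<mu>' < \<delta>" "\<nu> \<in> ?B"
        have nonneg: "0 \<le> stop_dist2 n (\<mu> i) (\<mu>' i)" for i
          unfolding stop_dist2_def by (intro sum_nonneg integral_nonneg_AE AE_I2) simp
        \<comment> \<open>A small sum of nonnegative terms makes each term small; the modulus
          \<delta> is common to all indices.\<close>
        have "stop_dist2 n (\<mu> i) (\<mu>' i) < \<delta>" for i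
          using member_le_sum[of i UNIV "\<lambda>i. stop_dist2 n (\<mu> i) (\<mu>' i)"] nonneg *(3) by fastforce
        thus "total_cost \<mu> \<nu> \<le> total_cost \<mu>' \<nu> + \<epsilon>"
          using * by (intro total_cost_mono uc) auto
      qed
    qed
  qed (use v e in auto)
qed

theorem game_has_value:
  "(INF \<mu>\<in>{\<mu>. \<forall>i. \<mu> i \<in> R}. SUP \<nu>\<in>R. ereal (total_cost \<mu> \<nu>)) =
   (SUP \<nu>\<in>R. INF \<mu>\<in>{\<mu>. \<forall>i. \<mu> i \<in> R}. ereal (total_cost \<mu> \<nu>))" (is "?upper = ?lower")
proof (rule antisym)
  show "?lower \<le> ?upper"
    by (intro SUP_least INF_greatest) (blast intro: INF_lower2 SUP_upper2 order_refl)
  show "?upper \<le> ?lower"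
  proof (rule ccontr)
    assume "\<not> ?upper \<le> ?lower"
    hence "?lower < ?upper" by simp
    then obtain v where v: "?lower < ereal v" "ereal v < ?upper" using ereal_dense2 by blast
    then obtain v' where v': "ereal v < ereal v'" "ereal v' < ?upper" using ereal_dense2 by blast
    \<comment> \<open>A third of the gap for each loss: rounding the minimizer's reply, the minimax
      on the grid, and rounding an arbitrary maximizer.\<close>
    define \<epsilon> where "\<epsilon> = (v' - v) / 3"
    have e: "\<epsilon> > 0" using v' by (simp add: \<epsilon>_def)
    obtain n where round: "\<And>i \<mu> \<nu>. \<mu> \<in> grid_strategies n \<Longrightarrow> \<nu> \<in> R \<Longrightarrow>
        expected_cost i \<mu> \<nu> \<le> expected_cost i \<mu> (round_strategy n \<nu>) + \<epsilon> \<and>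
        expected_cost i (round_strategy n \<nu>) \<mu> \<le> expected_cost i \<nu> \<mu> + \<epsilon>"
      using eventually_happens[OF rounding_costs_little[OF e]] by auto
    have "\<exists>\<mu>\<in>{\<mu>. \<forall>i. \<mu> i \<in> grid_strategies n}. total_cost \<mu> \<nu> < v + \<epsilon>"
      if \<nu>: "\<nu> \<in> grid_strategies n" for \<nu>
    proof -
      have \<nu>R: "\<nu> \<in> R" using \<nu> grid_strategies_subset by auto
      have "(INF \<mu>\<in>{\<mu>. \<forall>i. \<mu> i \<in> R}. ereal (total_cost \<mu> \<nu>)) < ereal v"
        using v(1) SUP_upper[OF \<nu>R] by (rule le_less_trans[rotated])
      then obtain \<mu> where \<mu>: "\<And>i. \<mu> i \<in> R" "total_cost \<mu> \<nu> < v" by (auto simp: INF_less_iff)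
      have "total_cost (\<lambda>i. round_strategy n (\<mu> i)) \<nu> \<le> total_cost \<mu> \<nu> + \<epsilon>"
        by (rule total_cost_mono) (use round[OF \<nu> \<mu>(1)] in auto)
      thus ?thesis
        using \<mu> by (intro bexI[of _ "\<lambda>i. round_strategy n (\<mu> i)"]) (auto simp: round_strategy_grid)
    qed
    from grid_minimax[OF this e] obtain \<mu> where \<mu>: "\<And>i. \<mu> i \<in> grid_strategies n"
      "\<And>\<nu>. \<nu> \<in> grid_strategies n \<Longrightarrow> total_cost \<mu> \<nu> \<le> v + \<epsilon> + \<epsilon>" by auto
    have "total_cost \<mu> \<nu> \<le> v'" if \<nu>: "\<nu> \<in> R" for \<nu>
    proof -
      have "total_cost \<mu> \<nu> \<le> total_cost \<mu> (round_strategy n \<nu>) + \<epsilon>"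
        by (rule total_cost_mono) (use round[OF \<mu>(1) \<nu>] in auto)
      also have "total_cost \<mu> (round_strategy n \<nu>) \<le> v + \<epsilon> + \<epsilon>"
        by (rule \<mu>(2)[OF round_strategy_grid[OF \<nu>]])
      finally show ?thesis by (simp add: \<epsilon>_def field_simps)
    qed
    hence "?upper \<le> ereal v'"
      using \<mu>(1) grid_strategies_subset[of n] by (intro INF_lower2[of \<mu>] SUP_least) auto
    thus False using v'(2) by simp
  qed
qed

end

section \<open>Strategies on the Wiener space\<close>

lemma coord_events_subset: "coord_events t T s \<subseteq> Pow (paths t T)"
  by (auto simp: coord_events_def)

lemma coord_events_mono: "s \<le> s' \<Longrightarrow> coord_events t T s \<subseteq> coord_events t T s'"
  unfolding coord_events_def by fastforce

lemma space_aug_filtration [simp]: "space (aug_filtration t T M s) = paths t T"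
  by (simp add: aug_filtration_def space_measure_of_conv)

text \<open>\<open>sigma\<close> falls back to the trivial algebra when a generator leaves the
  carrier; the hypothesis on \<open>space M\<close> keeps the null sets inside it.\<close>

lemma sets_aug_filtration:
  assumes "space M = paths t T"
  shows "sets (aug_filtration t T M s) = sigma_sets (paths t T) (coord_events t T s \<union> null_sets (completion M))"
  unfolding aug_filtration_def
proof (rule sets_measure_of)
  have "null_sets (completion M) \<subseteq> Pow (paths t T)"
    using sets.space_closed[of "completion M"] assms by auto
  thus "coord_events t T s \<union> null_sets (completion M) \<subseteq> Pow (paths t T)"
    using coord_events_subset[of t T s] by auto
qed

lemma aug_filtration_mono:
  assumes "space M = paths t T" "s \<le> s'"
  shows "subalgebra (aug_filtration t T M s') (aug_filtration t T M s)"
  unfolding subalgebra_def sets_aug_filtration[OF assms(1)]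
  using coord_events_mono[OF assms(2), of t T] by (auto intro!: sigma_sets_subseteq)

lemma space_restarted_measure [simp]: "space (restarted_measure T P t) = paths t T"
  by (simp add: restarted_measure_def coord_algebra_def space_measure_of_conv)

lemma round_up_stopping_time:
  assumes \<tau>: "\<tau> \<in> stopping_times T P t" and tT: "t \<le> T"
  shows "(\<lambda>w. round_up t T (Suc n) (\<tau> w)) \<in> stopping_times T P t"
proof -
  have rng: "\<tau> w \<in> {t..T}" if "w \<in> paths t T" for w using \<tau> that by (auto simp: stopping_times_def)
  have "Measurable.pred (filtration_Ht T P t s) (\<lambda>w. round_up t T (Suc n) (\<tau> w) \<le> s)" for s
  proof (cases "s < T")
    case True
    \<comment> \<open>The last point of the uncapped grid up to \<open>s\<close>: the rounded time
      is at most \<open>s\<close> iff \<tau> is at most \<open>s'\<close>, an event already known at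
      \<open>s'\<close> and hence at \<open>s\<close>.\<close>
    define s' where "s' = t + of_int \<lfloor>(s - t) * real (Suc n)\<rfloor> / real (Suc n)"
    have "of_int \<lfloor>(s - t) * real (Suc n)\<rfloor> / real (Suc n) \<le> s - t"
      by (subst pos_divide_le_eq) (auto simp del: of_nat_Suc)
    hence "s' \<le> s" by (simp add: s'_def del: of_nat_Suc)
    have "Measurable.pred (filtration_Ht T P t s') (\<lambda>w. \<tau> w \<le> s')"
      using \<tau> by (auto simp: stopping_times_def stopping_time_def)
    hence "Measurable.pred (filtration_Ht T P t s) (\<lambda>w. \<tau> w \<le> s')"
      by (rule measurable_from_subalg[rotated]) (intro aug_filtration_mono \<open>s' \<le> s\<close>, simp)
    thus ?thesis
      using round_up_le_iff[of "Suc n" s T t] True by (simp add: s'_def del: of_nat_Suc)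
  next
    case False
    hence "round_up t T (Suc n) x \<le> s" for x
      using round_up_le_horizon[of "Suc n" t T x] by simp
    thus ?thesis by simp
  qed
  moreover have "round_up t T (Suc n) (\<tau> w) \<in> {t..T}" if "w \<in> paths t T" for w
    using rng[OF that] round_up_ge[of "Suc n" "\<tau> w" T t] round_up_le_horizon[of "Suc n" t T "\<tau> w"] by auto
  ultimately show ?thesis
    unfolding stopping_times_def stopping_time_def mem_Collect_eq by (intro conjI allI funcsetI)
qed

lemma restart_paths:
  assumes "\<omega> \<in> paths 0 T" "t \<in> {0..T}"
  shows "restart t \<omega> \<in> paths t T"
proof -
  have \<omega>: "continuous_on UNIV \<omega>" "\<And>s. s \<ge> T \<Longrightarrow> \<omega> s = \<omega> T" using assms(1) unfolding paths_def by blast+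
  have cont: "continuous_on UNIV (\<lambda>s. \<omega> (max t s) - \<omega> t)"
    by (intro continuous_on_diff continuous_on_const continuous_on_compose2[OF \<omega>(1)] continuous_intros) auto
  have late: "\<omega> (max t s) - \<omega> t = \<omega> (max t T) - \<omega> t" if "T \<le> s" for s
    using \<omega>(2)[of "max t s"] \<omega>(2)[of "max t T"] that by (simp only: max.coboundedI2 order_refl)
  have early: "\<omega> (max t s) - \<omega> t = \<omega> (max t t) - \<omega> t" if "s \<le> t" for s
    using that by simp
  show ?thesis
    unfolding paths_def restart_def mem_Collect_eq using cont late early by blast
qed

section \<open>Measurability on the Wiener space\<close>

context
  fixes T t :: real and P :: "('d::finite) path measure"
  assumes P: "wiener_measure T P" and t: "t \<in> {0..T}"
begin

lemma space_wiener: "space P = paths 0 T"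
  using P by (simp add: wiener_measure_def)

lemma coord_events_wiener: "s \<le> T \<Longrightarrow> coord_events 0 T s \<subseteq> sets P"
proof -
  assume "s \<le> T"
  have "sets P = sigma_sets (paths 0 T) (coord_events 0 T T)"
    using P sets_measure_of[OF coord_events_subset[of 0 T T]]
    by (simp add: wiener_measure_def coord_algebra_def)
  thus ?thesis using coord_events_mono[OF \<open>s \<le> T\<close>, of 0 T] by auto
qed

lemma coordinate_measurable: "s \<in> {0..T} \<Longrightarrow> (\<lambda>\<omega>. \<omega> s) \<in> borel_measurable P"
proof (rule measurableI)
  fix A :: "(real ^ 'd) set" assume "s \<in> {0..T}" "A \<in> sets borel"
  hence "{\<omega> \<in> paths 0 T. \<omega> s \<in> A} \<in> coord_events 0 T T" unfolding coord_events_def by auto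
  moreover have "(\<lambda>\<omega>. \<omega> s) -` A \<inter> space P = {\<omega> \<in> paths 0 T. \<omega> s \<in> A}" using space_wiener by auto
  ultimately show "(\<lambda>\<omega>. \<omega> s) -` A \<inter> space P \<in> sets P" using coord_events_wiener[of T] by auto
qed simp

lemma restart_measurable: "restart t \<in> P \<rightarrow>\<^sub>M coord_algebra t T T"
  unfolding coord_algebra_def
proof (rule measurable_measure_of[OF coord_events_subset])
  show "restart t \<in> space P \<rightarrow> paths t T" using restart_paths t by (auto simp: space_wiener)
  fix E :: "'d path set" assume "E \<in> coord_events t T T"
  then obtain r A where E: "E = {\<omega> \<in> paths t T. \<omega> r \<in> A}" "r \<in> {t..T}" "A \<in> sets borel"
    by (auto simp: coord_events_def)
  have [measurable]: "(\<lambda>\<omega>. \<omega> r) \<in> borel_measurable P" "(\<lambda>\<omega>. \<omega> t) \<in> borel_measurable P"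
    using E t by (auto intro!: coordinate_measurable)
  have "(\<lambda>\<omega>. \<omega> r - \<omega> t) -` A \<inter> space P \<in> sets P"
    by (rule measurable_sets[OF _ E(3)]) measurable
  also have "(\<lambda>\<omega>. \<omega> r - \<omega> t) -` A \<inter> space P = restart t -` E \<inter> space P"
    using E(2) restart_paths[OF _ t] by (auto simp: E(1) restart_def space_wiener max_def)
  finally show "restart t -` E \<inter> space P \<in> sets P" .
qed

text \<open>The null sets added to the target are covered by null sets of the image measure, whose
  preimages are \<open>P\<close>-null; hence the completion on the source side.\<close>

lemma restart_measurable_completion: "restart t \<in> completion P \<rightarrow>\<^sub>M filtration_Ht T P t T"
proof (rule measurable_sigma_sets[OF sets_aug_filtration])
  show "coord_events t T T \<union> null_sets (completion (restarted_measure T P t)) \<subseteq> Pow (paths t T)"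
    using coord_events_subset[of t T T] sets.space_closed[of "completion (restarted_measure T P t)"] by auto
  show "restart t \<in> space (completion P) \<rightarrow> paths t T" using restart_paths t by (auto simp: space_wiener)
  fix E assume "E \<in> coord_events t T T \<union> null_sets (completion (restarted_measure T P t))"
  thus "restart t -` E \<inter> space (completion P) \<in> sets (completion P)"
  proof
    assume "E \<in> coord_events t T T"
    hence "E \<in> sets (coord_algebra t T T)"
      using sets_measure_of[OF coord_events_subset[of t T T]] by (auto simp: coord_algebra_def)
    thus ?thesis using measurable_sets[OF restart_measurable] by auto
  next
    assume "E \<in> null_sets (completion (restarted_measure T P t))"
    then obtain E' where E': "E' \<in> null_sets (restarted_measure T P t)" "E \<subseteq> E'"
      by (auto simp: null_sets_completion_iff2)
    hence "restart t -` E' \<inter> space P \<in> null_sets P"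
      by (simp add: restarted_measure_def null_sets_distr_iff[OF restart_measurable])
    thus ?thesis using E'(2) by (auto intro: null_sets_completion)
  qed
qed simp

lemma filtration_H_measurable_completion:
  assumes "F \<in> borel_measurable (filtration_H T P s)" "s \<le> T"
  shows "F \<in> borel_measurable (completion P)"
proof (rule measurable_from_subalg[OF _ assms(1)])
  have "sigma_sets (paths 0 T) (coord_events 0 T s \<union> null_sets (completion P)) \<subseteq> sets (completion P)"
    using sets.sigma_sets_subset[of "coord_events 0 T s \<union> null_sets (completion P)" "completion P"]
      coord_events_wiener[OF assms(2)] by (auto simp: space_wiener)
  thus "subalgebra (completion P) (filtration_H T P s)"
    by (simp add: subalgebra_def sets_aug_filtration space_wiener)
qed

end

section \<open>Continuity of the payoff functions along the state process\<close>

lemma bounded_lipschitz_continuous: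
  "bounded_lipschitz T \<phi> \<Longrightarrow> continuous_on ({0..T} \<times> UNIV) (\<lambda>(s, y). \<phi> s y)"
  unfolding bounded_lipschitz_def by (auto intro: lipschitz_on_continuous_on)

lemma bounded_lipschitz_section_continuous:
  assumes "bounded_lipschitz T \<phi>" "s \<in> {0..T}"
  shows "continuous_on UNIV (\<phi> s)"
proof -
  have "continuous_on UNIV (\<lambda>y. case (s, y) of (s, y) \<Rightarrow> \<phi> s y)"
    by (rule continuous_on_compose2[OF bounded_lipschitz_continuous[OF assms(1)]])
       (use assms(2) in \<open>auto intro!: continuous_on_Pair continuous_on_const continuous_on_id\<close>)
  thus ?thesis by simp
qed

lemma bounded_lipschitz_along_path:
  assumes "bounded_lipschitz T \<phi>" "continuous_on {t..T} Y" "0 \<le> t"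
  shows "continuous_on {t..T} (\<lambda>s. \<phi> s (Y s))"
proof -
  have "continuous_on {t..T} (\<lambda>s. case (s, Y s) of (s, y) \<Rightarrow> \<phi> s y)"
    by (rule continuous_on_compose2[OF bounded_lipschitz_continuous[OF assms(1)]])
       (use assms(2,3) in \<open>auto intro!: continuous_on_Pair continuous_on_id\<close>)
  thus ?thesis by simp
qed

theorem theorem3p2:
  fixes T :: real
    and P :: "('d::finite) path measure"
    and b :: "real \<Rightarrow> real ^ 'd \<Rightarrow> real ^ 'd"
    and a :: "real \<Rightarrow> real ^ 'd \<Rightarrow> real ^ 'd ^ 'd"
    and f h :: "'i::finite \<Rightarrow> real \<Rightarrow> real ^ 'd \<Rightarrow> real"
    and g :: "'i \<Rightarrow> real ^ 'd \<Rightarrow> real"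
    and X :: "real \<Rightarrow> real ^ 'd \<Rightarrow> real \<Rightarrow> 'd path \<Rightarrow> real ^ 'd"
  assumes T: "0 < T"
    and P: "wiener_measure T P"
    and b: "bounded_lipschitz T b"
    and a: "\<And>k l. bounded_lipschitz T (\<lambda>s y. a s y $ k $ l)"
    and f: "\<And>i. bounded_lipschitz T (f i)"
    and h: "\<And>i. bounded_lipschitz T (h i)"
    and g: "\<And>i. bounded (range (g i))" "\<And>i. \<exists>L. L-lipschitz_on UNIV (g i)"
    and fh: "\<And>i s y. s \<in> {0..T} \<Longrightarrow> f i s y \<le> h i s y"
    and fgh: "\<And>i y. f i T y \<le> g i y" "\<And>i y. g i y \<le> h i T y"
    and X: "\<And>t x. t \<in> {0..T} \<Longrightarrow> sde_solution T P b a t x (X t x)"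
  shows "\<forall>t\<in>{0..T}. \<forall>x. \<forall>p\<in>prob_simplex.
           upper_value T P X f h g t x p = lower_value T P X f h g t x p"
proof (intro ballI allI)
  fix t x and p :: "real ^ 'i"
  assume t: "t \<in> {0..T}" and p: "p \<in> prob_simplex"
  have "\<exists>c. (\<forall>s\<in>{0..T}. \<forall>y. \<bar>f i s y\<bar> \<le> c \<and> \<bar>h i s y\<bar> \<le> c) \<and> (\<forall>y. \<bar>g i y\<bar> \<le> c)" for i
  proof -
    obtain c1 c2 c3 where "\<And>s y. s \<in> {0..T} \<Longrightarrow> \<bar>f i s y\<bar> \<le> c1" "\<And>s y. s \<in> {0..T} \<Longrightarrow> \<bar>h i s y\<bar> \<le> c2"
      "\<And>y. \<bar>g i y\<bar> \<le> c3"
      using f[of i] h[of i] g(1)[of i] unfolding bounded_lipschitz_def bounded_iff by fastforce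
    thus ?thesis by (intro exI[of _ "max c1 (max c2 c3)"]) (auto simp: le_max_iff_disj)
  qed
  then obtain c where c: "\<And>i s y. s \<in> {0..T} \<Longrightarrow> \<bar>f i s y\<bar> \<le> c i" "\<And>i s y. s \<in> {0..T} \<Longrightarrow> \<bar>h i s y\<bar> \<le> c i"
    "\<And>i y. \<bar>g i y\<bar> \<le> c i" by metis
  define C where "C = Max (range c)"
  have cC: "c i \<le> C" for i unfolding C_def by simp
  have tT: "t \<le> T" "0 \<le> t" and sub: "s \<in> {t..T} \<Longrightarrow> s \<in> {0..T}" for s using t by auto
  have Xc: "continuous_on {t..T} (\<lambda>s. X t x s \<omega>)" if "\<omega> \<in> paths 0 T" for \<omega>
    using X[OF t, of x] that by (simp add: sde_solution_def)
  have Xm: "X t x s \<in> borel_measurable (completion P)" if "s \<in> {t..T}" for s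
    using X[OF t, of x] that by (intro filtration_H_measurable_completion[OF P t]) (auto simp: sde_solution_def)
  have compose: "(\<lambda>\<omega>. \<phi> (X t x s \<omega>)) \<in> borel_measurable (completion P)"
    if "continuous_on UNIV \<phi>" "s \<in> {t..T}" for \<phi> :: "real ^ 'd \<Rightarrow> real" and s
    using measurable_compose[OF Xm[OF that(2)] borel_measurable_continuous_onI[OF that(1)]] .
  interpret P: prob_space P using P by (simp add: wiener_measure_def)
  \<comment> \<open>The game lives on \<open>completion P\<close> because measurability of the state
    process and of \<open>restart t\<close> into the augmented filtration was established
    there.\<close>
  interpret dynkin_game "completion P" "filtration_Ht T P t T" "restart t" "randomized_stopping_times T P t"
    t T "X t x" f h g C "\<lambda>i. p $ i"
  proof (intro dynkin_game.intro dynkin_game_axioms.intro)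
    show "prob_space (completion P)" by (rule P.prob_space_completion)
    show "restart t \<in> completion P \<rightarrow>\<^sub>M filtration_Ht T P t T" by (rule restart_measurable_completion[OF P t])
    show "t \<le> T" by fact
    show "(\<lambda>(r, w). \<mu> r w) \<in> borel_measurable (unit_measure \<Otimes>\<^sub>M filtration_Ht T P t T)"
      if "\<mu> \<in> randomized_stopping_times T P t" for \<mu>
      using that by (simp add: randomized_stopping_times_def)
    show "\<mu> r w \<in> {t..T}"
      if "\<mu> \<in> randomized_stopping_times T P t" "r \<in> {0..1}" "w \<in> space (filtration_Ht T P t T)" for \<mu> r w
      using that by (auto simp: randomized_stopping_times_def stopping_times_def simp del: atLeastAtMost_iff)
    show "(\<lambda>r w. T) \<in> randomized_stopping_times T P t"
      using tT by (auto simp: randomized_stopping_times_def stopping_times_def stopping_time_def)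
    \<comment> \<open>For fixed \<open>r\<close> the mixture is one member of one of the two
      families, at an argument in [0, 1], so adaptedness is inherited; joint measurability comes
      from \<open>mix_strategy_measurable\<close>.\<close>
    show "mix_strategy \<theta> \<mu> \<mu>' \<in> randomized_stopping_times T P t"
      if "\<mu> \<in> randomized_stopping_times T P t" "\<mu>' \<in> randomized_stopping_times T P t" "\<theta> \<in> {0..1}" for \<mu> \<mu>' \<theta>
      using that mix_argument[OF that(3)] mix_strategy_measurable[OF that(3), of \<mu> _ \<mu>']
      by (simp add: randomized_stopping_times_def del: atLeastAtMost_iff)
         (simp add: mix_strategy_def del: atLeastAtMost_iff)
    show "(\<lambda>r w. round_up t T (Suc n) (\<mu> r w)) \<in> randomized_stopping_times T P t"
      if "\<mu> \<in> randomized_stopping_times T P t" for \<mu> n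
    proof -
      have "(\<lambda>z. round_up t T (Suc n) (case z of (r, w) \<Rightarrow> \<mu> r w))
          \<in> borel_measurable (unit_measure \<Otimes>\<^sub>M filtration_Ht T P t T)"
        using that by (intro measurable_compose[OF _ round_up_measurable]) (simp add: randomized_stopping_times_def)
      moreover have "\<forall>r\<in>{0..1}. (\<lambda>w. round_up t T (Suc n) (\<mu> r w)) \<in> stopping_times T P t"
        using that unfolding randomized_stopping_times_def
        by (intro ballI round_up_stopping_time tT(1)) blast
      ultimately show ?thesis by (simp add: randomized_stopping_times_def case_prod_beta)
    qed
    show "continuous_on {t..T} (\<lambda>s. f i s (X t x s \<omega>))" "continuous_on {t..T} (\<lambda>s. h i s (X t x s \<omega>))"
      if "\<omega> \<in> space (completion P)" for \<omega> i
      using that space_wiener[OF P t]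
      by (simp_all add: bounded_lipschitz_along_path[OF f Xc tT(2)] bounded_lipschitz_along_path[OF h Xc tT(2)])
    show "(\<lambda>\<omega>. f i s (X t x s \<omega>)) \<in> borel_measurable (completion P)"
      "(\<lambda>\<omega>. h i s (X t x s \<omega>)) \<in> borel_measurable (completion P)" if "s \<in> {t..T}" for i s
      by (intro compose bounded_lipschitz_section_continuous[OF f] bounded_lipschitz_section_continuous[OF h]
          sub that)+
    show "(\<lambda>\<omega>. g i (X t x T \<omega>)) \<in> borel_measurable (completion P)" for i
      using g(2)[of i] tT by (intro compose) (auto intro: lipschitz_on_continuous_on)
    show "\<bar>f i s y\<bar> \<le> C" "\<bar>h i s y\<bar> \<le> C" if "s \<in> {t..T}" for i s y
      using c(1,2)[OF sub[OF that], of i y] cC[of i] by linarith+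
    show "\<bar>g i y\<bar> \<le> C" for i y using c(3)[of i y] cC[of i] by linarith
    show "f i s y \<le> h i s y" if "s \<in> {t..T}" for i s y using fh sub that by blast
    show "f i T y \<le> g i y" "g i y \<le> h i T y" for i y by (rule fgh)+
    show "0 \<le> p $ i" for i using p by (simp add: prob_simplex_def)
    show "(\<Sum>i\<in>UNIV. p $ i) = 1" using p by (simp add: prob_simplex_def)
  qed
  have "payoff T P X f h g t x p \<mu> \<nu> = total_cost \<mu> \<nu>" for \<mu> \<nu>
    by (simp add: payoff_def payoff_i_def total_cost_def expected_cost_def cost_def)
  thus "upper_value T P X f h g t x p = lower_value T P X f h g t x p"
    using game_has_value by (simp add: upper_value_def lower_value_def)
qed

end
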